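(* Let $r \ge 1$ be an integer, let $G$ be a graph with odd girth at least $15$, and let $X \subseteq V(G)$. If \[ \chi(X) \ge \begin{cases} 16r+5 & \text{if } r \text{ is even},\\ 16r+11 & \text{if } r \text{ is odd},\end{cases} \] then $G$ contains a quasi-$r$-arithmetic rope in $X$.
   Context: Graphs are finite, simple and undirected. The odd girth of a graph is the length of its shortest odd cycle ($\infty$ if there is none). For $X \subseteq V(G)$, $\chi(X)$ denotes the chromatic number of the induced subgraph $G[X]$. The $G$-distance between two vertices is their distance in $G$. The length of a path is its number of edges; a $uv$-path is a path with ends $u$ and $v$. A quasi-$r$-arithmetic rope in a graph $G$ consists of vertices $q_1,\dots,q_r$ together with paths $Q_{i,1}, Q_{i,2}$ of $G$ for $i \in [r]=\{1,\dots,r\}$ such that (taking indices modulo $r$): (a) each $Q_{i,1}$ and each $Q_{i,2}$ is a $q_iq_{i+1}$-path; (b) each $Q_{i,1}$ has odd length; (c) for each $i$, $Q_{i,2}$ or $Q_{i+1,2}$ has even length; (d) for every $(h_1,\dots,h_r) \in \{1,2\}^r$, the graph $Q_{1,h_1} \cup \dots \cup Q_{r,h_r}$ is an induced cycle of $G$; (e) $q_1,\dots,q_r$ have pairwise $G$-distance at least $6$. The paths $Q_{i,1}$ and $Q_{i,2}$ are allowed to coincide (when both have odd length). In the degenerate case $r=1$, a "$q_1q_1$-path" is understood as a cycle through $q_1$. If all vertices of all the paths $Q_{i,1}, Q_{i,2}$ are contained in $X \subseteq V(G)$, we say that $G$ has (contains) a quasi-$r$-arithmetic rope in $X$; condition (e)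 still refers to distance in $G$, not in $G[X]$. *)

theory Defs
  imports Main "HOL-Library.Extended_Nat"
begin

datatype 'a ugraph = Graph (verts: "'a set") (edges: "'a set set")

definition simple_graph :: "'a ugraph \<Rightarrow> bool" where
  "simple_graph G \<longleftrightarrow> finite (verts G) \<and> (\<forall>e\<in>edges G. e \<subseteq> verts G \<and> card e = 2)"

definition induced :: "'a ugraph \<Rightarrow> 'a set \<Rightarrow> 'a ugraph" where
  "induced G X = Graph (verts G \<inter> X) {e \<in> edges G. e \<subseteq> X}"

definition proper_colouring :: "'a ugraph \<Rightarrow> nat \<Rightarrow> ('a \<Rightarrow> nat) \<Rightarrow> bool" where
  "proper_colouring G k c \<longleftrightarrow>
     (\<forall>v\<in>verts G. c v < k) \<and> (\<forall>u v. {u, v} \<in> edges G \<longrightarrow> c u \<noteq> c v)"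

(* For a finite simple graph some k always works, so LEAST is well-behaved. *)
definition chromatic_number :: "'a ugraph \<Rightarrow> nat" where
  "chromatic_number G = (LEAST k. \<exists>c. proper_colouring G k c)"

(* Walks, paths and cycles are nonempty lists of vertices; a cycle repeats its
   first vertex at the end. The length is the number of edges. *)

definition walk :: "'a ugraph \<Rightarrow> 'a list \<Rightarrow> bool" where
  "walk G p \<longleftrightarrow> p \<noteq> [] \<and> set p \<subseteq> verts G \<and>
     (\<forall>i. Suc i < length p \<longrightarrow> {p ! i, p ! Suc i} \<in> edges G)"

definition walk_length :: "'a list \<Rightarrow> nat" where
  "walk_length p = length p - 1"

definition path :: "'a ugraph \<Rightarrow> 'a list \<Rightarrow> bool" where
  "path G p \<longleftrightarrow> walk G p \<and> distinct p"

definition path_between :: "'a ugraph \<Rightarrow> 'a \<Rightarrow> 'a \<Rightarrow> 'a list \<Rightarrow> bool" where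
  "path_between G u v p \<longleftrightarrow> path G p \<and> hd p = u \<and> last p = v"

definition cycle :: "'a ugraph \<Rightarrow> 'a list \<Rightarrow> bool" where
  "cycle G p \<longleftrightarrow> walk G p \<and> hd p = last p \<and> distinct (tl p) \<and> walk_length p \<ge> 3"

(* The infimum of the empty set of enat is infinity. *)
definition odd_girth :: "'a ugraph \<Rightarrow> enat" where
  "odd_girth G = (INF p \<in> {p. cycle G p \<and> odd (walk_length p)}. enat (walk_length p))"

definition graph_dist :: "'a ugraph \<Rightarrow> 'a \<Rightarrow> 'a \<Rightarrow> enat" where
  "graph_dist G u v = (INF p \<in> {p. path_between G u v p}. enat (walk_length p))"

definition walk_graph :: "'a list \<Rightarrow> 'a ugraph" where
  "walk_graph p = Graph (set p) {{p ! i, p ! Suc i} | i. Suc i < length p}"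

definition graph_Union :: "'i set \<Rightarrow> ('i \<Rightarrow> 'a ugraph) \<Rightarrow> 'a ugraph" where
  "graph_Union I H = Graph (\<Union>i\<in>I. verts (H i)) (\<Union>i\<in>I. edges (H i))"

definition induced_cycle :: "'a ugraph \<Rightarrow> 'a ugraph \<Rightarrow> bool" where
  "induced_cycle G H \<longleftrightarrow> (\<exists>c. cycle G c \<and> H = walk_graph c) \<and> H = induced G (verts H)"

(* The indices 1, ..., r are shifted to 0, ..., r - 1, so that the cyclic successor
   of i is Suc i mod r. Q i 1 and Q i 2 are the two paths at position i. When r = 1,
   a "path" from q 0 to q 0 is a cycle through q 0, traversed from q 0 to q 0. *)
definition quasi_arithmetic_rope ::
  "'a ugraph \<Rightarrow> nat \<Rightarrow> (nat \<Rightarrow> 'a) \<Rightarrow> (nat \<Rightarrow> nat \<Rightarrow> 'a list) \<Rightarrow> bool" where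
  "quasi_arithmetic_rope G r q Q \<longleftrightarrow>
     (\<forall>i<r. \<forall>j\<in>{1, 2}.
        if r = 1 then cycle G (Q i j) \<and> hd (Q i j) = q i
        else path_between G (q i) (q (Suc i mod r)) (Q i j)) \<and>
     (\<forall>i<r. odd (walk_length (Q i 1))) \<and>
     (\<forall>i<r. even (walk_length (Q i 2)) \<or> even (walk_length (Q (Suc i mod r) 2))) \<and>
     (\<forall>h. (\<forall>i<r. h i \<in> {1, 2}) \<longrightarrow>
        induced_cycle G (graph_Union {..<r} (\<lambda>i. walk_graph (Q i (h i))))) \<and>
     (\<forall>i<r. \<forall>j<r. i \<noteq> j \<longrightarrow> graph_dist G (q i) (q j) \<ge> 6)"

definition has_quasi_arithmetic_rope_in :: "'a ugraph \<Rightarrow> nat \<Rightarrow> 'a set \<Rightarrow> bool" where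
  "has_quasi_arithmetic_rope_in G r X \<longleftrightarrow>
     (\<exists>q Q. quasi_arithmetic_rope G r q Q \<and> (\<forall>i<r. \<forall>j\<in>{1, 2}. set (Q i j) \<subseteq> X))"

end

theory Submission
  imports Defs
begin

text \<open>
  Let \<open>D\<close> be connected and not \<open>k\<close>-colourable, and delete stable sets \<open>B\<^sub>0, B\<^sub>1, \<dots>\<close> from it one after
  another, labelling the vertices of \<open>B\<^sub>t\<close> by the parity of the length of an induced path from a
  root to them. As long as no edge between deleted vertices of equal label occurs next to a remaining
  component of large chromatic number, the labelling is a 2-colouring of the boundary, so only a
  bounded number of colours is lost. Such an edge \<open>xy\<close>, on the other hand, gives induced paths of
  both parities to \<open>x\<close> and to \<open>y\<close>, that is, a link of the rope.

  Take a level of large chromatic number in a breadth-first search of \<open>G[X]\<close>. Applied to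
  neighbourhoods in a breadth-first search inside this level, the argument yields a link
  \<open>P\<close>. But the rope has to be closed through the higher levels, so the parents of the remaining
  region must avoid \<open>P\<close>. Hence apply the argument again, deleting for the vertices of \<open>P\<close> in turn
  the vertices that have a common parent with them: either nothing goes wrong and the rest is clean,
  or an edge between two deleted vertices produces another link, which uses only a part of \<open>P\<close> that
  is already clean. The odd girth enters since balls of radius 6 are 2-colourable; removing them
  keeps the ends of the links far apart and disposes of the remaining local interference.
  One link costs \<open>3 + 3 + 2 = 8\<close> colours, and breadth-first search costs a factor of 2.
\<close>

text \<open>The parity of the closing path cannot be controlled. Hence every link is built in both
  parities, the closing path is absorbed into the last link, and the two versions of that link are
  swapped if necessary; every \<open>Q i 2\<close> then has even length.

  A new link must be joined to the remaining region by a path, and the parents of that path are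
  beyond control. So the connecting path \<open>R\<close> and the region \<open>F\<close> are kept
  apart, and only the parents and grandparents of \<open>F\<close> are required to avoid the rope.
  This is enough, because the closing path climbs through a parent of a vertex of \<open>F\<close>,
  even if it leaves \<open>R\<close> before reaching \<open>F\<close>.

  The number 15: two walks of equal length at most 6 from one vertex, with an edge between their
  ends, close up to an odd walk of length at most 13. Radius 6 is the forbidden distance 5 plus one,
  since the ball is taken around one end of the edge \<open>xy\<close> while the next rope vertex
  may be the other end.

  The total of \<open>16 * r + 4\<close> colours is twice \<open>8 * r + 2\<close>: besides the 8
  colours per link, 2 are spent on a ball around the start \<open>a\<close>.\<close>

lemma relpowp_sym:
  assumes "symp R" "(R ^^ n) u v" shows "(R ^^ n) v u"
  using assms(2)
proof (induction n arbitrary: v)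
  case (Suc n)
  then obtain w where "(R ^^ n) u w" "R w v" by auto
  then show ?case using Suc.IH[of w] assms(1) by (meson relpowp_Suc_I2 sympD)
qed simp

lemma relpowp_append: "(R ^^ m) u v \<Longrightarrow> (R ^^ n) v w \<Longrightarrow> (R ^^ (m + n)) u w"
  by (auto simp: relpowp_add)

section \<open>Colourings, components and induced paths\<close>

locale adjacency =
  fixes adj :: "'a \<Rightarrow> 'a \<Rightarrow> bool"
  assumes adj_sym: "adj u v \<Longrightarrow> adj v u"
    and adj_irrefl: "\<not> adj u u"
begin

definition colr :: "nat \<Rightarrow> 'a set \<Rightarrow> bool" where
  "colr k S \<longleftrightarrow> (\<exists>c :: 'a \<Rightarrow> nat. (\<forall>v\<in>S. c v < k) \<and> (\<forall>u\<in>S. \<forall>v\<in>S. adj u v \<longrightarrow> c u \<noteq> c v))"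

definition step :: "'a set \<Rightarrow> 'a \<Rightarrow> 'a \<Rightarrow> bool" where
  "step S u v \<longleftrightarrow> u \<in> S \<and> v \<in> S \<and> adj u v"

definition conn :: "'a set \<Rightarrow> bool" where
  "conn S \<longleftrightarrow> S \<noteq> {} \<and> (\<forall>u\<in>S. \<forall>v\<in>S. (step S)\<^sup>*\<^sup>* u v)"

definition iscomp :: "'a set \<Rightarrow> 'a set \<Rightarrow> bool" where
  "iscomp D S \<longleftrightarrow> conn D \<and> D \<subseteq> S \<and> (\<forall>u\<in>D. \<forall>v\<in>S. adj u v \<longrightarrow> v \<in> D)"

definition comp :: "'a set \<Rightarrow> 'a \<Rightarrow> 'a set" where
  "comp S v = {u \<in> S. (step S)\<^sup>*\<^sup>* v u}"

definition anti :: "'a set \<Rightarrow> 'a set \<Rightarrow> bool" where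
  "anti S T \<longleftrightarrow> (\<forall>u\<in>S. \<forall>v\<in>T. u \<noteq> v \<and> \<not> adj u v)"

definition near :: "nat \<Rightarrow> 'a \<Rightarrow> 'a \<Rightarrow> bool" where
  "near n u v \<longleftrightarrow> (\<exists>m\<le>n. (adj ^^ m) u v)"

lemma symp_adj: "symp adj"
  using adj_sym by (auto intro: sympI)

lemma adj_commute: "adj u v \<longleftrightarrow> adj v u"
  using adj_sym by blast

lemma symp_step: "symp (step S)"
  using adj_sym by (auto intro: sympI simp: step_def)

lemma step_rtranclp_sym: "(step S)\<^sup>*\<^sup>* u v \<Longrightarrow> (step S)\<^sup>*\<^sup>* v u"
  using symp_rtranclp[OF symp_step] by (rule sympD)

lemma colr_mono: "colr k S \<Longrightarrow> T \<subseteq> S \<Longrightarrow> k \<le> l \<Longrightarrow> colr l T"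
  unfolding colr_def by (meson order_less_le_trans subsetD)

lemma colr_stable:
  assumes "\<forall>u\<in>S. \<forall>v\<in>S. \<not> adj u v" "k \<ge> 1" shows "colr k S"
  unfolding colr_def using assms by (intro exI[of _ "\<lambda>_. 0"]) auto

lemma colr_Un:
  assumes "colr k S" "colr l T" shows "colr (k + l) (S \<union> T)"
proof -
  obtain c d :: "'a \<Rightarrow> nat" where
    c: "\<forall>v\<in>S. c v < k" "\<forall>u\<in>S. \<forall>v\<in>S. adj u v \<longrightarrow> c u \<noteq> c v" and
    d: "\<forall>v\<in>T. d v < l" "\<forall>u\<in>T. \<forall>v\<in>T. adj u v \<longrightarrow> d u \<noteq> d v"
    using assms unfolding colr_def by blast
  have "c v < k + l" if "v \<in> S" for v using c(1) that by fastforce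
  moreover have "k + d v \<noteq> c u" if "u \<in> S" for u v using c(1) that by fastforce
  ultimately show ?thesis unfolding colr_def
    using c d by (intro exI[of _ "\<lambda>v. if v \<in> S then c v else k + d v"]) (auto dest: sym)
qed

lemma iscomp_comp:
  assumes "v \<in> S" shows "iscomp (comp S v) S" "v \<in> comp S v"
proof -
  have step_comp: "(step (comp S v))\<^sup>*\<^sup>* v u" if "(step S)\<^sup>*\<^sup>* v u" for u
    using that
  proof (induction rule: rtranclp_induct)
    case (step y z)
    then have "step (comp S v) y z"
      by (auto simp: step_def comp_def intro: rtranclp.rtrancl_into_rtrancl)
    with step.IH show ?case by (rule rtranclp.rtrancl_into_rtrancl)
  qed simp
  show "v \<in> comp S v" using assms by (simp add: comp_def)
  moreover have "(step (comp S v))\<^sup>*\<^sup>* u w" if "u \<in> comp S v" "w \<in> comp S v" for u w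
    using that step_comp[of u] step_comp[of w] step_rtranclp_sym[of "comp S v" v u]
    by (auto simp: comp_def intro: rtranclp_trans)
  ultimately have "conn (comp S v)" unfolding conn_def by blast
  moreover have "w \<in> comp S v" if "u \<in> comp S v" "w \<in> S" "adj u w" for u w
    using that by (auto simp: comp_def step_def intro: rtranclp.rtrancl_into_rtrancl)
  ultimately show "iscomp (comp S v) S"
    by (auto simp: iscomp_def comp_def)
qed

lemma comp_eq:
  assumes "v \<in> S" "u \<in> comp S v" shows "comp S u = comp S v"
  using assms unfolding comp_def
  by (auto intro: rtranclp_trans step_rtranclp_sym)

text \<open>One colouring is chosen per component rather than per vertex, so adjacent vertices use
  the same one; proper colourings of the components then combine to the proper colouring
  \<open>\<lambda>v. c v v\<close> of \<open>S\<close>.\<close>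

lemma comp_choice:
  assumes "\<And>D. iscomp D S \<Longrightarrow> \<exists>c :: 'a \<Rightarrow> nat. P D c"
  obtains c :: "'a \<Rightarrow> 'a \<Rightarrow> nat" where
    "\<And>v. v \<in> S \<Longrightarrow> P (comp S v) (c v)"
    "\<And>u v. u \<in> S \<Longrightarrow> v \<in> S \<Longrightarrow> adj u v \<Longrightarrow> comp S u = comp S v \<and> c u = c v"
proof -
  have "\<exists>f. \<forall>D. iscomp D S \<longrightarrow> P D (f D)" using assms by metis
  then obtain f where f: "\<And>D. iscomp D S \<Longrightarrow> P D (f D)" by blast
  show thesis
  proof (rule that[of "\<lambda>v. f (comp S v)"])
    fix u v assume uv: "u \<in> S" "v \<in> S" "adj u v"
    then have "v \<in> comp S u" using iscomp_comp[of u S] unfolding iscomp_def by blast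
    then show "comp S u = comp S v \<and> f (comp S u) = f (comp S v)" using comp_eq uv by metis
  qed (use f iscomp_comp in blast)
qed

lemma colr_comps:
  assumes "\<And>D. iscomp D S \<Longrightarrow> colr k D" shows "colr k S"
proof -
  obtain c where c: "\<And>v. v \<in> S \<Longrightarrow> (\<forall>u\<in>comp S v. c v u < k) \<and>
        (\<forall>u\<in>comp S v. \<forall>w\<in>comp S v. adj u w \<longrightarrow> c v u \<noteq> c v w)"
    "\<And>u v. u \<in> S \<Longrightarrow> v \<in> S \<Longrightarrow> adj u v \<Longrightarrow> comp S u = comp S v \<and> c u = c v"
    using comp_choice[of S "\<lambda>D c. (\<forall>u\<in>D. c u < k) \<and> (\<forall>u\<in>D. \<forall>w\<in>D. adj u w \<longrightarrow> c u \<noteq> c w)"]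
      assms unfolding colr_def by blast
  show ?thesis unfolding colr_def
  proof (intro exI[of _ "\<lambda>v. c v v"] conjI ballI impI)
    fix u v assume "u \<in> S" "v \<in> S" "adj u v"
    then show "c u u \<noteq> c v v" using c iscomp_comp(2) by metis
  qed (use c iscomp_comp(2) in blast)
qed

lemma big_comp:
  assumes "\<not> colr k S" obtains D where "iscomp D S" "\<not> colr k D"
  using assms colr_comps by blast

section \<open>The colouring argument\<close>

text \<open>A component of \<open>D0\<close> minus the first \<open>t\<close> sets is carried along such that the labelling of its
  boundary is proper but does not extend to a \<open>k\<close>-colouring. A new boundary vertex in conflict with
  an old one has no neighbour in a component of large chromatic number (else we are done), so it can
  be given a third colour.\<close>

lemma colouring_process:
  fixes B :: "nat \<Rightarrow> 'a set" and \<beta> :: "nat \<Rightarrow> nat" and k N :: nat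
  defines "Xs t \<equiv> \<Union>s<t. B s" and "\<tau> v \<equiv> LEAST t. v \<in> B t"
  assumes D0: "conn D0" "\<not> colr k D0" and k: "k \<ge> 3"
    and \<beta>: "\<And>t. \<beta> t < 2"
    and stable: "\<And>t u v. t < N \<Longrightarrow> u \<in> B t \<inter> D0 \<Longrightarrow> v \<in> B t \<inter> D0 \<Longrightarrow> \<not> adj u v"
  obtains (conflict) t x y D where "t < N" "x \<in> B t \<inter> D0 - Xs t" "y \<in> Xs t \<inter> D0" "adj x y"
      "\<beta> (\<tau> y) = \<beta> t" "iscomp D (D0 - Xs (Suc t))" "\<not> colr (k - 3) D" "\<exists>z\<in>D. adj x z"
  | (clean) D where "iscomp D (D0 - Xs N)" "\<not> colr (k - 2) D"
proof -
  define \<phi> where "\<phi> v = \<beta> (\<tau> v)" for v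
  define bd where "bd D = {v \<in> D0 - D. \<exists>u\<in>D. adj u v}" for D
  define valid where "valid D \<longleftrightarrow> (\<forall>u\<in>bd D. \<forall>v\<in>bd D. adj u v \<longrightarrow> \<phi> u \<noteq> \<phi> v) \<and>
     \<not> (\<exists>c :: 'a \<Rightarrow> nat. (\<forall>v\<in>D \<union> bd D. c v < k) \<and> (\<forall>v\<in>bd D. c v = \<phi> v) \<and>
         (\<forall>u\<in>D \<union> bd D. \<forall>v\<in>D \<union> bd D. adj u v \<longrightarrow> c u \<noteq> c v))" for D
  have \<phi>2: "\<phi> v < 2" for v using \<beta> by (simp add: \<phi>_def)
  show thesis
  proof (rule ccontr)
    assume neg: "\<not> thesis"
    have noconf: False if "t < N" "x \<in> B t \<inter> D0 - Xs t" "y \<in> Xs t \<inter> D0" "adj x y"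
      "\<beta> (\<tau> y) = \<beta> t" "iscomp D (D0 - Xs (Suc t))" "\<not> colr (k - 3) D" "\<exists>z\<in>D. adj x z" for t x y D
      using that conflict neg by blast
    have "t \<le> N \<Longrightarrow> \<exists>D. iscomp D (D0 - Xs t) \<and> valid D" for t
    proof (induction t)
      case 0
      have "bd D0 = {}" by (auto simp: bd_def)
      moreover have "\<not> (\<exists>c :: 'a \<Rightarrow> nat. (\<forall>v\<in>D0. c v < k) \<and> (\<forall>u\<in>D0. \<forall>v\<in>D0. adj u v \<longrightarrow> c u \<noteq> c v))"
        using D0(2) unfolding colr_def .
      ultimately have "valid D0" unfolding valid_def by simp
      then show ?case using D0(1) by (intro exI[of _ D0]) (auto simp: iscomp_def Xs_def)
    next
      case (Suc t)
      then obtain D where D: "iscomp D (D0 - Xs t)" "valid D" by auto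
      have tN: "t < N" using Suc by simp
      have bdX: "bd D \<subseteq> Xs t" using D(1) by (auto simp: bd_def iscomp_def)
      have DX: "D \<subseteq> D0" "D \<inter> Xs t = {}" using D(1) by (auto simp: iscomp_def)
      define S where "S = D - B t"
      \<comment> \<open>Colour 2 will be safe on \<open>B1\<close>: it lies in the stable set
        \<open>B t\<close>, and all other boundary colours are below 2.\<close>
      define B1 where "B1 = {x \<in> B t \<inter> D. \<exists>y\<in>bd D. adj x y \<and> \<phi> y = \<beta> t}"
      have \<tau>t: "\<phi> x = \<beta> t" if "x \<in> B t \<inter> D" for x
      proof -
        have "\<tau> x = t" unfolding \<tau>_def
          by (rule Least_equality) (use that DX in \<open>auto simp: Xs_def not_less[symmetric]\<close>)
        then show ?thesis by (simp add: \<phi>_def)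
      qed
      have SE: "iscomp E (D0 - Xs (Suc t))" if "iscomp E S" for E
        unfolding iscomp_def
      proof (intro conjI ballI impI)
        show "conn E" "E \<subseteq> D0 - Xs (Suc t)"
          using that DX by (auto simp: iscomp_def S_def Xs_def lessThan_Suc)
        fix u v assume uv: "u \<in> E" "v \<in> D0 - Xs (Suc t)" "adj u v"
        then have "v \<in> D" using that D(1) by (auto simp: iscomp_def S_def Xs_def lessThan_Suc)
        then have "v \<in> S" using uv by (auto simp: S_def Xs_def)
        then show "v \<in> E" using that uv by (auto simp: iscomp_def)
      qed
      have bdE: "bd E \<subseteq> bd D \<union> (B t \<inter> D)" if "iscomp E S" for E
        using that D(1) by (auto simp: bd_def iscomp_def S_def)
      show ?case
      proof (rule ccontr)
        assume no: "\<not> ?case"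
        \<comment> \<open>A colouring of \<open>E\<close> alone that fits its boundary once
          \<open>B1\<close> is recoloured by 2. Such colourings of all components of
          \<open>S\<close> glue to an extension of \<phi> to \<open>D\<close>.\<close>
        define good where "good E c \<longleftrightarrow> (\<forall>v\<in>E. c v < k) \<and> (\<forall>u\<in>E. \<forall>v\<in>E. adj u v \<longrightarrow> c u \<noteq> c v) \<and>
          (\<forall>u\<in>E. \<forall>v\<in>bd E. adj u v \<longrightarrow> c u \<noteq> (if v \<in> B1 then 2 else \<phi> v))" for E and c :: "'a \<Rightarrow> nat"
        have ex: "\<exists>c. good E c" if E: "iscomp E S" for E
        \<comment> \<open>A small component gives up the colours 0, 1, 2 and so fits any boundary.
          For a large one, the absence of the conflict outcome keeps \<open>B1\<close> off its
          boundary, and its failure to be valid supplies an extension of \<phi>.\<close>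
        proof (cases "colr (k - 3) E")
          case True
          then obtain c :: "'a \<Rightarrow> nat" where c: "\<forall>v\<in>E. c v < k - 3" "\<forall>u\<in>E. \<forall>v\<in>E. adj u v \<longrightarrow> c u \<noteq> c v"
            unfolding colr_def by blast
          show ?thesis unfolding good_def
          proof (intro exI[of _ "\<lambda>v. c v + 3"] conjI ballI impI)
            fix u v show "c u + 3 \<noteq> (if v \<in> B1 then 2 else \<phi> v)" using \<phi>2[of v] by simp
          qed (use c in \<open>auto simp: less_diff_conv\<close>)
        next
          case False
          have nB1: "v \<notin> B1" if "v \<in> bd E" for v
          proof
            assume "v \<in> B1"
            then obtain y where y: "v \<in> B t" "v \<in> D" "y \<in> bd D" "adj v y" "\<phi> y = \<beta> t"
              by (auto simp: B1_def)
            have "\<exists>z\<in>E. adj v z" using that adj_sym by (auto simp: bd_def)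
            moreover have "y \<in> Xs t \<inter> D0" using y(3) bdX by (auto simp: bd_def)
            ultimately show False
              using noconf[of t v y E] y tN DX SE[OF E] False by (auto simp: \<phi>_def)
          qed
          have proper: "\<phi> u \<noteq> \<phi> v" if uv: "u \<in> bd E" "v \<in> bd E" "adj u v" for u v
          proof -
            have *: "\<phi> u \<noteq> \<phi> v" if "u \<in> B t \<inter> D" "u \<notin> B1" "v \<in> bd D" "adj u v" for u v
              using that \<tau>t[of u] by (auto simp: B1_def)
            consider "u \<in> bd D" "v \<in> bd D" | "u \<in> B t \<inter> D" "v \<in> bd D" | "u \<in> bd D" "v \<in> B t \<inter> D"
              | "u \<in> B t \<inter> D" "v \<in> B t \<inter> D" using bdE[OF E] uv by blast
            then show ?thesis
            proof cases
              case 1 then show ?thesis using D(2) uv unfolding valid_def by blast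
            next
              case 2 then show ?thesis using * nB1 uv by blast
            next
              case 3 then show ?thesis using *[of v u] nB1 uv adj_sym by metis
            next
              case 4 then show ?thesis using stable[OF tN, of u v] DX uv by blast
            qed
          qed
          have "\<not> valid E" using no SE[OF E] by blast
          with proper obtain c :: "'a \<Rightarrow> nat" where c: "\<forall>v\<in>E \<union> bd E. c v < k" "\<forall>v\<in>bd E. c v = \<phi> v"
            "\<forall>u\<in>E \<union> bd E. \<forall>v\<in>E \<union> bd E. adj u v \<longrightarrow> c u \<noteq> c v"
            unfolding valid_def by blast
          show ?thesis unfolding good_def
          proof (intro exI[of _ c] conjI ballI impI)
            fix u v assume uv: "u \<in> E" "v \<in> bd E" "adj u v"
            then have "c u \<noteq> c v" using c(3) by blast
            then show "c u \<noteq> (if v \<in> B1 then 2 else \<phi> v)" using c(2) nB1 uv by simp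
          qed (use c in blast)+
        qed
        obtain c :: "'a \<Rightarrow> 'a \<Rightarrow> nat" where c0: "\<And>v. v \<in> S \<Longrightarrow> good (comp S v) (c v)"
            and c2: "\<And>u v. u \<in> S \<Longrightarrow> v \<in> S \<Longrightarrow> adj u v \<Longrightarrow> comp S u = comp S v \<and> c u = c v"
          using comp_choice[of S good] ex by metis
        have c1: "\<And>v u. v \<in> S \<Longrightarrow> u \<in> comp S v \<Longrightarrow> c v u < k"
            "\<And>v u w. v \<in> S \<Longrightarrow> u \<in> comp S v \<Longrightarrow> w \<in> comp S v \<Longrightarrow> adj u w \<Longrightarrow> c v u \<noteq> c v w"
            "\<And>v u w. v \<in> S \<Longrightarrow> u \<in> comp S v \<Longrightarrow> w \<in> bd (comp S v) \<Longrightarrow> adj u w \<Longrightarrow>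
              c v u \<noteq> (if w \<in> B1 then 2 else \<phi> w)"
          using c0 unfolding good_def by blast+
        \<comment> \<open>The glued colouring agrees with \<phi> on \<open>bd D\<close>, which
          contradicts \<open>valid D\<close>.\<close>
        define d where "d v = (if v \<in> S then c v v else if v \<in> B1 then 2 else \<phi> v)" for v
        have nS: "v \<in> bd D \<or> v \<in> B t \<inter> D" if "v \<in> D \<union> bd D" "v \<notin> S" for v
          using that by (auto simp: S_def)
        have bdDn: "v \<notin> D" if "v \<in> bd D" for v using that by (simp add: bd_def)
        have B1D: "B1 \<subseteq> B t \<inter> D" by (auto simp: B1_def)
        have neq: "d u \<noteq> d v" if uv: "u \<in> S" "v \<in> D \<union> bd D" "adj u v" for u v
        proof (cases "v \<in> S")
          case True
          then have "comp S u = comp S v" "c u = c v" using c2 uv by auto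
          then show ?thesis
            using c1(2)[of u u v] True uv iscomp_comp(2)[of u S] iscomp_comp(2)[of v S] by (simp add: d_def)
        next
          case False
          have "v \<notin> comp S u" using False by (auto simp: comp_def)
          then have "v \<in> bd (comp S u)" using uv iscomp_comp(2)[of u S] DX
            by (auto simp: bd_def)
          then show ?thesis using c1(3)[of u u v] uv False iscomp_comp(2)[of u S] by (simp add: d_def)
        qed
        have neq2: "d u \<noteq> d v" if uv: "u \<in> D \<union> bd D" "v \<in> D \<union> bd D" "adj u v" "u \<notin> S" "v \<notin> S" for u v
        proof -
          consider "u \<in> bd D" "v \<in> bd D" | "u \<in> B t \<inter> D" "v \<in> bd D" | "u \<in> bd D" "v \<in> B t \<inter> D"
              | "u \<in> B t \<inter> D" "v \<in> B t \<inter> D" using nS uv by blast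
          then show ?thesis
          proof cases
            case 1
            then have "\<phi> u \<noteq> \<phi> v" using D(2) uv unfolding valid_def by blast
            moreover have "u \<notin> B1" "v \<notin> B1" using 1 bdDn B1D by auto
            ultimately show ?thesis using uv by (simp add: d_def)
          next
            case 2
            have "v \<notin> B1" using 2 bdDn B1D by auto
            then show ?thesis using 2 uv \<phi>2[of v] \<tau>t[of u] by (auto simp: d_def B1_def)
          next
            case 3
            have "u \<notin> B1" using 3 bdDn B1D by auto
            moreover have "adj v u" using uv adj_sym by blast
            ultimately show ?thesis using 3 uv \<phi>2[of u] \<tau>t[of v] by (auto simp: d_def B1_def)
          next
            case 4 then show ?thesis using stable[OF tN, of u v] DX uv by blast
          qed
        qed
        have "d u \<noteq> d v" if "u \<in> D \<union> bd D" "v \<in> D \<union> bd D" "adj u v" for u v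
          using neq[of u v] neq[of v u] neq2[of u v] that adj_sym by metis
        moreover have "d v < k" for v
          using c1(1)[of v v] iscomp_comp(2)[of v S] \<phi>2[of v] k by (simp add: d_def)
        moreover have "d v = \<phi> v" if "v \<in> bd D" for v
          using bdDn[OF that] B1D by (auto simp: d_def S_def)
        ultimately show False using D(2) unfolding valid_def by blast
      qed
    qed
    then obtain D where D: "iscomp D (D0 - Xs N)" "valid D" by blast
    \<comment> \<open>Otherwise \<open>D\<close> could be coloured with 0 and 1 reserved for the
      boundary.\<close>
    have "\<not> colr (k - 2) D"
    proof
      assume "colr (k - 2) D"
      then obtain c :: "'a \<Rightarrow> nat" where c: "\<forall>v\<in>D. c v < k - 2" "\<forall>u\<in>D. \<forall>v\<in>D. adj u v \<longrightarrow> c u \<noteq> c v"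
        unfolding colr_def by blast
      define d where "d v = (if v \<in> D then c v + 2 else \<phi> v)" for v
      have "d v < k" if "v \<in> D \<union> bd D" for v
        using c(1) \<phi>2[of v] k unfolding d_def by (fastforce simp: less_diff_conv)
      moreover have "d v = \<phi> v" if "v \<in> bd D" for v using that by (simp add: d_def bd_def)
      moreover have "d u \<noteq> d v" if uv: "u \<in> D \<union> bd D" "v \<in> D \<union> bd D" "adj u v" for u v
      proof (cases "u \<in> D \<or> v \<in> D")
        case True
        then show ?thesis using c(2) uv \<phi>2[of u] \<phi>2[of v]
          by (cases "u \<in> D"; cases "v \<in> D") (simp_all add: d_def)
      next
        case False
        then show ?thesis using D(2) uv unfolding d_def valid_def by auto
      qed
      ultimately show False using D(2) unfolding valid_def by blast
    qed
    then show False using clean D(1) neg by blast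
  qed
qed

end

lemma parity_eq: "m mod 2 = n mod 2 \<Longrightarrow> m \<le> Suc n \<Longrightarrow> n \<le> Suc m \<Longrightarrow> m = n" for m n :: nat
  by presburger

context adjacency
begin

section \<open>Induced paths and distance levels\<close>

text \<open>Each vertex is compared with all later ones, so there are no chords. Since
  \<open>length\<close> counts vertices, a list of even \<open>length\<close> is a path of odd
  length; links and forks are stated in this form.\<close>

fun ipath :: "'a list \<Rightarrow> bool" where
  "ipath [] \<longleftrightarrow> False"
| "ipath [x] \<longleftrightarrow> True"
| "ipath (x # y # xs) \<longleftrightarrow> adj x y \<and> x \<notin> set (y # xs) \<and> (\<forall>z\<in>set xs. \<not> adj x z) \<and> ipath (y # xs)"

lemma ipath_nonempty: "ipath p \<Longrightarrow> p \<noteq> []"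
  by auto

lemma ipath_distinct: "ipath p \<Longrightarrow> distinct p"
  by (induction p rule: ipath.induct) auto

lemma ipath_append:
  assumes "ipath p" "ipath q" "last p = hd q" "anti (set (butlast p)) (set (tl q))"
  shows "ipath (p @ tl q)"
  using assms
proof (induction p rule: ipath.induct)
  case (2 x)
  then show ?case using ipath_nonempty by (cases q) auto
next
  case (3 x y xs)
  have IH: "ipath ((y # xs) @ tl q)"
    using 3 by (auto simp: anti_def split: if_splits)
  have a: "\<not> adj x z \<and> x \<noteq> z" if "z \<in> set (tl q)" for z
    using 3(5) that by (auto simp: anti_def)
  have b: "\<not> adj x z" if "z \<in> set xs" for z using 3(2) that by simp
  show ?case using IH a b 3(2) by auto
qed simp

lemma ipath_prefix: "ipath (p @ q) \<Longrightarrow> p \<noteq> [] \<Longrightarrow> ipath p"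
  by (induction p rule: ipath.induct) auto

lemma ipath_take: "ipath p \<Longrightarrow> n > 0 \<Longrightarrow> ipath (take n p)"
  using ipath_prefix[of "take n p" "drop n p"] ipath_nonempty[of p] by auto

lemma ipath_snoc:
  assumes "ipath p" "v \<notin> set p" "adj (last p) v" "\<And>z. z \<in> set (butlast p) \<Longrightarrow> \<not> adj z v"
  shows "ipath (p @ [v])"
proof -
  have ne: "p \<noteq> []" using assms(1) ipath_nonempty by blast
  have "last p \<noteq> v" using assms(2) ne last_in_set by metis
  then have "ipath [last p, v]" using assms(3) by simp
  moreover have "anti (set (butlast p)) (set (tl [last p, v]))"
    using assms(2,4) in_set_butlastD by (fastforce simp: anti_def)
  ultimately show ?thesis using ipath_append[OF assms(1), of "[last p, v]"] by simp
qed

text \<open>Breadth-first level: the distance from \<open>w\<close> in the subgraph induced by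
  \<open>K\<close>. For unreachable \<open>v\<close> the value is unspecified, hence the
  reachability assumptions of \<open>lev_walk\<close> and its consequences.\<close>

definition lev :: "'a set \<Rightarrow> 'a \<Rightarrow> 'a \<Rightarrow> nat" where
  "lev K w v = (LEAST n. (step K ^^ n) w v)"

lemma lev_walk: "(step K)\<^sup>*\<^sup>* w v \<Longrightarrow> (step K ^^ lev K w v) w v"
  unfolding lev_def by (rule LeastI_ex) (rule rtranclp_imp_relpowp)

lemma lev_le: "(step K ^^ n) w v \<Longrightarrow> lev K w v \<le> n"
  unfolding lev_def by (rule Least_le)

lemma lev_root [simp]: "lev K w w = 0"
  using lev_le[of 0 K w w] by simp

lemma lev_0: "(step K)\<^sup>*\<^sup>* w v \<Longrightarrow> lev K w v = 0 \<Longrightarrow> v = w"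
  using lev_walk[of K w v] by simp

lemma lev_adj: "(step K)\<^sup>*\<^sup>* w u \<Longrightarrow> step K u v \<Longrightarrow> lev K w v \<le> Suc (lev K w u)"
  by (rule lev_le) (auto intro: lev_walk)

lemma lev_pred:
  assumes "(step K)\<^sup>*\<^sup>* w v" "lev K w v = Suc n"
  obtains u where "step K u v" "lev K w u = n" "(step K)\<^sup>*\<^sup>* w u"
proof -
  obtain u where u: "(step K ^^ n) w u" "step K u v"
    using lev_walk[OF assms(1)] assms(2) by auto
  then have r: "(step K)\<^sup>*\<^sup>* w u" using relpowp_imp_rtranclp by metis
  have "lev K w u = n"
    using lev_le[OF u(1)] lev_adj[OF r u(2)] assms(2) by linarith
  then show thesis using that u r by blast
qed

lemma step_relpowp: "(step K ^^ n) u v \<Longrightarrow> (adj ^^ n) u v"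
proof (induction n arbitrary: v)
  case (Suc n)
  then obtain b where "(step K ^^ n) u b" "step K b v" by auto
  then show ?case using Suc.IH by (meson relpowp_Suc_I step_def)
qed simp

lemma near_mono: "near m u v \<Longrightarrow> m \<le> n \<Longrightarrow> near n u v"
  unfolding near_def using le_trans by blast

lemma near_refl: "near n u u"
  unfolding near_def by (intro exI[of _ 0]) simp

lemma near_step: "near n u v \<Longrightarrow> adj v w \<Longrightarrow> near (Suc n) u w"
  unfolding near_def by (metis Suc_le_mono relpowp_Suc_I)

lemma near_sym: "near n u v \<Longrightarrow> near n v u"
  unfolding near_def using relpowp_sym[OF symp_adj] by blast

end

section \<open>Graphs of odd girth at least 15\<close>

locale girth15 = adjacency +
  assumes no_odd: "odd n \<Longrightarrow> n < 15 \<Longrightarrow> \<not> (adj ^^ n) u u"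
begin

lemma no_triangle: "adj u v \<Longrightarrow> adj v w \<Longrightarrow> adj u w \<Longrightarrow> False"
proof -
  assume "adj u v" "adj v w" "adj u w"
  then have "(adj ^^ Suc (Suc (Suc 0))) u u" using adj_sym by (auto intro!: relcomppI)
  then show False using no_odd[of 3 u] by (simp add: numeral_3_eq_3)
qed

text \<open>Both walks and the edge form a closed walk of length \<open>2 * n + 1\<close>, at most
  13. This is the source of stability for levels and for siblings.\<close>

lemma walks_not_adj:
  assumes "(adj ^^ n) w u" "(adj ^^ n) w v" "n \<le> 6" shows "\<not> adj u v"
proof
  assume "adj u v"
  then have "(adj ^^ Suc n) w v" using assms(1) by (rule relpowp_Suc_I[rotated])
  then have "(adj ^^ (Suc n + n)) w w"
    by (rule relpowp_append[OF _ relpowp_sym[OF symp_adj assms(2)]])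
  then show False using no_odd[of "Suc n + n" w] assms(3) by simp
qed

lemma level_stable:
  assumes "(step K)\<^sup>*\<^sup>* w u" "(step K)\<^sup>*\<^sup>* w v" "lev K w u = lev K w v" "lev K w u \<le> 6"
  shows "\<not> adj u v"
  using walks_not_adj[of "lev K w u" w u v] assms(3,4) step_relpowp[OF lev_walk[OF assms(1)]]
    step_relpowp[OF lev_walk[OF assms(2)]] by simp

text \<open>The parity of the distance from \<open>c\<close> is a colouring: distances of adjacent
  vertices differ by at most 1, and \<open>level_stable\<close> excludes equality.\<close>

lemma ball_two_colourable: "colr 2 {v. near 6 c v}"
proof -
  have step_UNIV: "step UNIV = adj" by (auto simp: step_def fun_eq_iff)
  have reach: "(step UNIV)\<^sup>*\<^sup>* c v \<and> lev UNIV c v \<le> 6" if "near 6 c v" for v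
  proof -
    obtain m where "m \<le> 6" "(step UNIV ^^ m) c v" using \<open>near 6 c v\<close> unfolding near_def step_UNIV by blast
    then show ?thesis using lev_le[of m UNIV c v] relpowp_imp_rtranclp[of m "step UNIV" c v] by simp
  qed
  show ?thesis unfolding colr_def
  proof (intro exI[of _ "\<lambda>v. lev UNIV c v mod 2"] conjI ballI impI)
    fix u v assume uv: "u \<in> {v. near 6 c v}" "v \<in> {v. near 6 c v}" "adj u v"
    have "lev UNIV c u \<le> Suc (lev UNIV c v)" "lev UNIV c v \<le> Suc (lev UNIV c u)"
      using lev_adj[of UNIV c] reach uv adj_sym by (auto simp: step_UNIV)
    moreover have "lev UNIV c u \<noteq> lev UNIV c v"
      using level_stable[of UNIV c u v] reach uv by auto
    ultimately show "lev UNIV c u mod 2 \<noteq> lev UNIV c v mod 2" by presburger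
  qed simp
qed

text \<open>What remains has distance at least 7 from \<open>c\<close>, hence at least 6 from every
  neighbour of \<open>c\<close>.\<close>

lemma remove_ball:
  assumes "\<not> colr (k + 2) D"
  obtains F where "iscomp F {v \<in> D. \<not> near 6 c v}" "\<not> colr k F"
proof (rule big_comp)
  show "\<not> colr k {v \<in> D. \<not> near 6 c v}"
  proof
    assume "colr k {v \<in> D. \<not> near 6 c v}"
    then have "colr (k + 2) ({v \<in> D. \<not> near 6 c v} \<union> {v. near 6 c v})"
      using colr_Un ball_two_colourable by blast
    then show False using assms colr_mono[of "k + 2" _ D "k + 2"] by blast
  qed
qed (use that in blast)

text \<open>Breadth-first search from \<open>w\<close>: the sets of the colouring process are the neighbourhoods in
  order of the distance from \<open>w\<close>, so a conflict is an edge inside a level, and the two geodesics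
  to its ends have the same length.\<close>

lemma fork_exists:
  assumes F: "conn F" "finite F" "w \<notin> F" "\<exists>z\<in>F. adj w z" "\<not> colr k F" "k \<ge> 3"
  obtains X Y x y D where "hd X = w" "hd Y = w" "last X = x" "last Y = y"
    "ipath (X @ [y])" "ipath (Y @ [x])" "length X = length Y" "length X \<ge> 2"
    "set (tl X) \<subseteq> F" "set (tl Y) \<subseteq> F"
    "x \<in> F" "y \<in> F" "adj x y" "conn D" "D \<subseteq> F" "\<not> colr (k - 3) D" "x \<notin> D" "y \<notin> D"
    "anti (set X \<union> set Y - {x, y}) D" "\<exists>z\<in>D. adj x z"
proof -
  define K where "K = insert w F"
  define l where "l = lev K w"
  obtain z0 where z0: "z0 \<in> F" "adj w z0" using F by blast
  have reach: "(step K)\<^sup>*\<^sup>* w v" if "v \<in> K" for v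
  proof (cases "v = w")
    case False
    then have "(step F)\<^sup>*\<^sup>* z0 v" using that F(1) z0 by (auto simp: conn_def K_def)
    then have "(step K)\<^sup>*\<^sup>* z0 v" by (rule rtranclp_mono[THEN predicate2D, rotated]) (auto simp: step_def K_def)
    then show ?thesis by (rule converse_rtranclp_into_rtranclp[rotated]) (use z0 in \<open>auto simp: step_def K_def\<close>)
  qed simp
  have l_adj: "l v \<le> Suc (l u)" if "u \<in> K" "v \<in> K" "adj u v" for u v
    using lev_adj[of K w u v] reach that by (simp add: l_def step_def)
  have l_pos: "l v > 0" if "v \<in> F" for v
    using lev_0[of K w v] reach[of v] that F(3) by (auto simp: l_def K_def)
  obtain zs0 where zs0: "set zs0 = K" using finite_list[of K] F(2) by (auto simp: K_def)
  \<comment> \<open>Sorting by level puts the first neighbour \<open>zs ! \<tau> v\<close> of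
    \<open>v\<close> one level closer to the root, so following \<tau> backwards traces a
    geodesic.\<close>
  define zs where "zs = sort_key l zs0"
  have zs: "set zs = K" "sorted (map l zs)" using zs0 by (auto simp: zs_def)
  define N where "N = length zs"
  have zsK: "zs ! t \<in> K" if "t < N" for t using that zs(1) by (auto simp: N_def)
  have order: "s < t" if "s < N" "t < N" "l (zs ! s) < l (zs ! t)" for s t
    using that sorted_nth_mono[OF zs(2), of t s] by (fastforce simp: N_def)
  define B where "B t = (if t < N then {v \<in> F. adj (zs ! t) v} else {})" for t
  define \<tau> where "\<tau> v = (LEAST t. v \<in> B t)" for v
  have tau: "\<tau> v < N" "adj (zs ! \<tau> v) v" "l v = Suc (l (zs ! \<tau> v))" if v: "v \<in> F" for v
  proof -
    have vK: "v \<in> K" using v by (simp add: K_def)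
    obtain n where n: "l v = Suc n" using l_pos[OF v] gr0_implies_Suc by blast
    obtain u where u: "step K u v" "l u = n"
      using lev_pred[OF reach[OF vK], of n] n unfolding l_def by blast
    obtain s where s: "s < N" "zs ! s = u" using u zs(1) by (auto simp: step_def N_def in_set_conv_nth)
    have vs: "v \<in> B s" using s u v by (auto simp: B_def step_def)
    have \<tau>: "v \<in> B (\<tau> v)" "\<tau> v \<le> s" unfolding \<tau>_def using vs by (rule LeastI, rule Least_le)
    then show t: "\<tau> v < N" "adj (zs ! \<tau> v) v" by (auto simp: B_def split: if_splits)
    have "l (zs ! \<tau> v) \<le> n" using order[of s "\<tau> v"] s t \<tau> u by (meson leD leI)
    then show "l v = Suc (l (zs ! \<tau> v))" using l_adj[of "zs ! \<tau> v" v] t zsK vK n by fastforce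
  qed
  have tau_less: "\<tau> (zs ! s) < s" if "s < N" "zs ! s \<in> F" for s
    using order[of "\<tau> (zs ! s)" s] tau[OF that(2)] that by simp
  \<comment> \<open>The geodesic through first neighbours. That \<open>z\<close> is adjacent to
    \<open>v\<close> or at least two levels above it allows the path to be extended inside a level;
    the index bound shows that neighbours of the path are already deleted.\<close>
  have geo: "\<exists>P. ipath P \<and> hd P = w \<and> last P = v \<and> length P = Suc (l v) \<and> set (tl P) \<subseteq> F \<and>
    (\<forall>z\<in>set (butlast P). (adj z v \<or> Suc (l z) < l v) \<and> l z < l v \<and> (\<exists>s\<le>\<tau> v. s < N \<and> z = zs ! s))"
    if "v \<in> K" for v
    using that
  proof (induction "l v" arbitrary: v)
    case 0
    then have "v = w" using lev_0[of K w v] reach by (simp add: l_def)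
    then show ?case by (intro exI[of _ "[w]"]) (simp add: l_def)
  next
    case (Suc n)
    have vF: "v \<in> F" using Suc(2,3) by (auto simp: K_def l_def)
    define u where "u = zs ! \<tau> v"
    have u: "u \<in> K" "adj u v" "l v = Suc (l u)" using tau[OF vF] zsK by (auto simp: u_def)
    obtain P where P: "ipath P" "hd P = w" "last P = u" "length P = Suc (l u)" "set (tl P) \<subseteq> F"
      "\<forall>z\<in>set (butlast P). (adj z u \<or> Suc (l z) < l u) \<and> l z < l u \<and> (\<exists>s\<le>\<tau> u. s < N \<and> z = zs ! s)"
      using Suc(1)[of u] Suc(2) u by auto
    have ne: "P \<noteq> []" using P ipath_nonempty by blast
    have setP: "set P = insert u (set (butlast P))"
      using append_butlast_last_id[OF ne] P(3) by (metis list.simps(15) rotate1.simps(2) set_rotate1)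
    have small: "l z < l u" if "z \<in> set (butlast P)" for z using P(6) that by blast
    have "v \<notin> set P" using setP small u(3) by fastforce
    moreover have "\<not> adj z v" if "z \<in> set (butlast P)" for z
    proof
      assume "adj z v"
      moreover obtain s where "s < N" "z = zs ! s" using P(6) \<open>z \<in> set (butlast P)\<close> by blast
      ultimately show False using zsK l_adj[of z v] small[OF that] u Suc(3) by simp
    qed
    ultimately have "ipath (P @ [v])" using ipath_snoc[OF P(1)] P(3) u by blast
    moreover have "(adj z v \<or> Suc (l z) < l v) \<and> l z < l v \<and> (\<exists>s\<le>\<tau> v. s < N \<and> z = zs ! s)"
      if "z \<in> set P" for z
    proof (cases "z = u")
      case True
      then show ?thesis using u tau(1)[OF vF] u_def by auto
    next
      case False
      then have z: "z \<in> set (butlast P)" using that setP by blast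
      then obtain s where s: "s \<le> \<tau> u" "s < N" "z = zs ! s" using P(6) by blast
      have "u \<in> F" using small[OF z] u(1) by (auto simp: K_def l_def)
      then have "\<tau> u < \<tau> v" using tau_less[of "\<tau> v"] tau(1)[OF vF] by (simp add: u_def)
      then show ?thesis using s small[OF z] u(3) by (auto intro!: exI[of _ s])
    qed
    moreover have "set (tl (P @ [v])) \<subseteq> F" using P(5) vF ne by (cases P) auto
    ultimately show ?case using P ne u(3) by (intro exI[of _ "P @ [v]"]) simp
  qed
  have stable: "\<not> adj u v" if "t < N" "u \<in> B t \<inter> F" "v \<in> B t \<inter> F" for t u v
    using that no_triangle[of "zs ! t" u v] by (auto simp: B_def)
  show thesis
  \<comment> \<open>The label is the parity of the level of the vertices first met from
    \<open>zs ! t\<close>. Adjacent vertices of equal label therefore lie in the same level.\<close>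
  proof (rule colouring_process[of F k "\<lambda>t. Suc (l (zs ! t)) mod 2" N B])
    fix D assume D: "iscomp D (F - (\<Union>s<N. B s))"
    \<comment> \<open>Every vertex of \<open>F\<close> has a first neighbour in the list, so nothing
      remains at the end and the clean outcome is impossible.\<close>
    have "F \<subseteq> (\<Union>s<N. B s)"
    proof
      fix v assume "v \<in> F"
      then show "v \<in> (\<Union>s<N. B s)" using tau[of v] by (auto simp: B_def intro!: bexI[of _ "\<tau> v"])
    qed
    then show thesis using D by (auto simp: iscomp_def conn_def)
  next
    fix t x y D
    assume t: "t < N" and x: "x \<in> B t \<inter> F - (\<Union>s<t. B s)" and y: "y \<in> (\<Union>s<t. B s) \<inter> F"
      and xy: "adj x y"
      and par: "Suc (l (zs ! (LEAST t. y \<in> B t))) mod 2 = Suc (l (zs ! t)) mod 2"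
      and D: "iscomp D (F - (\<Union>s<Suc t. B s))" "\<not> colr (k - 3) D" "\<exists>z\<in>D. adj x z"
    have xyF: "x \<in> F" "y \<in> F" "x \<in> K" "y \<in> K" using x y by (auto simp: K_def)
    have \<tau>x: "\<tau> x = t" unfolding \<tau>_def
      by (rule Least_equality) (use x in \<open>auto simp: not_less[symmetric]\<close>)
    obtain s where s: "s < t" "y \<in> B s" using y by blast
    have \<tau>y: "\<tau> y < t" using Least_le[of "\<lambda>t. y \<in> B t" s] s by (simp add: \<tau>_def)
    have "l y mod 2 = l x mod 2"
      using par tau(3)[OF xyF(1)] tau(3)[OF xyF(2)] \<tau>x by (simp add: \<tau>_def)
    moreover have "l y \<le> Suc (l x)" "l x \<le> Suc (l y)" 
      using l_adj[of x y] l_adj[of y x] xyF xy adj_sym[OF xy] by simp_all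
    ultimately have lxy: "l x = l y" using parity_eq by metis
    obtain X where X: "ipath X" "hd X = w" "last X = x" "length X = Suc (l x)" "set (tl X) \<subseteq> F"
      "\<forall>z\<in>set (butlast X). (adj z x \<or> Suc (l z) < l x) \<and> l z < l x \<and> (\<exists>s\<le>\<tau> x. s < N \<and> z = zs ! s)"
      using geo[OF xyF(3)] by blast
    obtain Y where Y: "ipath Y" "hd Y = w" "last Y = y" "length Y = Suc (l y)" "set (tl Y) \<subseteq> F"
      "\<forall>z\<in>set (butlast Y). (adj z y \<or> Suc (l z) < l y) \<and> l z < l y \<and> (\<exists>s\<le>\<tau> y. s < N \<and> z = zs ! s)"
      using geo[OF xyF(4)] by blast
    \<comment> \<open>A vertex before \<open>u\<close> that is adjacent to \<open>v\<close> is at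
      most one level above \<open>v\<close>, hence adjacent to \<open>u\<close> as well: a
      triangle.\<close>
    have ext: "ipath (P @ [v])" if P: "ipath P" "last P = u" "u \<in> F" "v \<in> F" "adj u v" "l u = l v"
      "\<forall>z\<in>set (butlast P). (adj z u \<or> Suc (l z) < l u) \<and> l z < l u \<and> (\<exists>s\<le>i. s < N \<and> z = zs ! s)"
      for P u v i
    proof (rule ipath_snoc[OF P(1)])
      have ne: "P \<noteq> []" using P ipath_nonempty by blast
      have setP: "set P = insert u (set (butlast P))"
        using append_butlast_last_id[OF ne] P(2) by (metis list.simps(15) rotate1.simps(2) set_rotate1)
      show "v \<notin> set P" using setP P(5,6,7) adj_irrefl by fastforce
      show "adj (last P) v" using P by simp
      fix z assume z: "z \<in> set (butlast P)"
      show "\<not> adj z v"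
      proof
        assume zv: "adj z v"
        obtain s where "s < N" "z = zs ! s" using P(7) z by blast
        then have zK: "z \<in> K" using zsK by blast
        have "l v \<le> Suc (l z)" using l_adj[OF zK _ zv] P(4) by (simp add: K_def)
        then have "adj z u" using bspec[OF P(7) z] P(6) by simp
        then show False using no_triangle[of z u v] P(5) zv by blast
      qed
    qed
    have bl: "z \<in> set (butlast P)" if "z \<in> set P" "z \<noteq> last P" for z and P :: "'a list"
      using that by (cases P rule: rev_cases) auto
    \<comment> \<open>All these vertices are \<open>zs ! s\<close> with \<open>s \<le> t\<close>.
      Their neighbours in \<open>F\<close> have been deleted before \<open>D\<close> is formed, and
      so have they themselves if they lie in \<open>F\<close>.\<close>
    have anti: "anti (set X \<union> set Y - {x, y}) D"
      unfolding anti_def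
    proof (intro ballI)
      fix z d assume z: "z \<in> set X \<union> set Y - {x, y}" and d: "d \<in> D"
      have "\<exists>s\<le>t. s < N \<and> z = zs ! s"
      proof (cases "z \<in> set X")
        case True
        then show ?thesis using X(3,6) bl[of z X] z \<tau>x by auto
      next
        case False
        then obtain s where "s \<le> \<tau> y" "s < N" "z = zs ! s" using Y(3,6) bl[of z Y] z by auto
        then show ?thesis using \<tau>y by (intro exI[of _ s]) auto
      qed
      then obtain s where s: "s \<le> t" "s < N" "z = zs ! s" by blast
      have dF: "d \<in> F" "d \<notin> (\<Union>s<Suc t. B s)" using d D(1) by (auto simp: iscomp_def)
      have "d \<notin> B s" using dF s by auto
      then have "\<not> adj z d" using s dF by (simp add: B_def)
      moreover have "z \<noteq> d"
      proof
        assume "z = d"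
        then have "\<tau> d < s" "d \<in> B (\<tau> d)" using tau_less[of s] tau[of d] s dF by (auto simp: B_def)
        then show False using dF s by auto
      qed
      ultimately show "z \<noteq> d \<and> \<not> adj z d" by blast
    qed
    have nD: "x \<notin> D" "y \<notin> D" using x s D(1) by (auto simp: iscomp_def)
    show thesis
    proof (rule that[of X Y x y D])
      show "ipath (X @ [y])" using ext[of X x y] X xyF xy lxy by blast
      show "ipath (Y @ [x])" using ext[of Y y x] Y xyF xy lxy adj_sym by metis
      show "length X \<ge> 2" using X(4) l_pos[OF xyF(1)] by simp
      show "conn D" "D \<subseteq> F" using D(1) by (auto simp: iscomp_def)
    qed (use X Y lxy xyF xy D nD anti in auto)
  qed (use F stable in auto)
qed

end

section \<open>Induced paths from walks, and shortest paths between sets\<close>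

context adjacency
begin

lemma anti_mono: "anti S T \<Longrightarrow> S' \<subseteq> S \<Longrightarrow> T' \<subseteq> T \<Longrightarrow> anti S' T'"
  unfolding anti_def by blast

lemma anti_Un1: "anti (S \<union> S') T \<longleftrightarrow> anti S T \<and> anti S' T"
  unfolding anti_def by blast

lemma anti_Un2: "anti S (T \<union> T') \<longleftrightarrow> anti S T \<and> anti S T'"
  unfolding anti_def by blast

lemma ipath_suffix: "ipath (p @ q) \<Longrightarrow> q \<noteq> [] \<Longrightarrow> ipath q"
proof (induction p)
  case (Cons x p)
  then show ?case by (cases "p @ q") auto
qed simp

lemma ipath_Cons:
  assumes "ipath p" "adj x (hd p)" "x \<notin> set p" "\<And>z. z \<in> set (tl p) \<Longrightarrow> \<not> adj x z"
  shows "ipath (x # p)"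
  using assms by (cases p) auto

lemma set_hd_tl: "p \<noteq> [] \<Longrightarrow> set p = insert (hd p) (set (tl p))"
  by (cases p) auto

lemma set_butlast_last: "p \<noteq> [] \<Longrightarrow> set p = insert (last p) (set (butlast p))"
  by (cases p rule: rev_cases) auto

text \<open>Induction from the front: the new first vertex either occurs on the induced path
  already, which is then cut there, or it jumps to its last neighbour on that path, which leaves no
  chord.\<close>

lemma shorten_walk:
  assumes "successively adj p" "p \<noteq> []"
  shows "\<exists>q. ipath q \<and> hd q = hd p \<and> last q = last p \<and> set q \<subseteq> set p \<and> length q \<le> length p"
  using assms
proof (induction p)
  case (Cons x p)
  show ?case
  proof (cases "p = []")
    case True
    then show ?thesis by (intro exI[of _ "[x]"]) simp
  next
    case False
    then obtain q where q: "ipath q" "hd q = hd p" "last q = last p" "set q \<subseteq> set p"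
      "length q \<le> length p" and xp: "adj x (hd p)"
      using Cons by (auto simp: successively_Cons)
    have qne: "q \<noteq> []" using q(1) by (rule ipath_nonempty)
    show ?thesis
    proof (cases "x \<in> set q")
      case True
      then obtain us vs where "q = us @ x # vs" by (meson split_list)
      then show ?thesis using q False ipath_suffix[of us "x # vs"]
        by (intro exI[of _ "x # vs"]) auto
    next
      case x: False
      have "\<exists>z\<in>set q. adj x z" using xp q(2) qne by (metis hd_in_set)
      then obtain us v vs where v: "q = us @ v # vs" "adj x v" "\<forall>z\<in>set vs. \<not> adj x z"
        by (metis split_list_last_prop)
      have "ipath (x # v # vs)"
        using ipath_suffix[of us "v # vs"] q(1) v x by (intro ipath_Cons[of "v # vs"]) auto
      then show ?thesis using q v False by (intro exI[of _ "x # v # vs"]) auto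
    qed
  qed
qed simp

lemma conn_walk:
  assumes "conn D" "u \<in> D" "v \<in> D"
  shows "\<exists>p. successively adj p \<and> p \<noteq> [] \<and> hd p = u \<and> last p = v \<and> set p \<subseteq> D"
proof -
  have "(step D)\<^sup>*\<^sup>* u v" using assms by (simp add: conn_def)
  then show ?thesis
  proof (induction rule: rtranclp_induct)
    case base
    then show ?case using assms(2) by (intro exI[of _ "[u]"]) simp
  next
    case (step y z)
    then obtain p where "successively adj p" "p \<noteq> []" "hd p = u" "last p = y" "set p \<subseteq> D" by blast
    then show ?case using step(2) by (intro exI[of _ "p @ [z]"]) (auto simp: successively_append_iff step_def)
  qed
qed

text \<open>By \<open>shorten_walk\<close> no walk from \<open>S\<close> through \<open>D\<close>
  into \<open>F\<close> is shorter than the path chosen below, so every shortcut is a contradiction;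
  \<open>R\<close> omits its last vertex, the one in \<open>F\<close>. The last property lets
  another vertex of \<open>S\<close> touch \<open>R\<close> only where \<open>hd R\<close> does; if
  \<open>S\<close> consists of the ends of an edge, triangle-freeness then excludes any
  contact.\<close>

lemma short_path:
  assumes D: "conn D" and S: "S \<inter> D = {}" "s \<in> S" "z \<in> D" "adj s z"
    and F: "F \<subseteq> D" "F \<noteq> {}" "\<And>u v. u \<in> S \<Longrightarrow> v \<in> F \<Longrightarrow> \<not> adj u v"
  obtains R where "ipath R" "hd R \<in> S" "set (tl R) \<subseteq> D" "\<exists>v\<in>F. adj (last R) v"
    "anti (set (butlast R)) F" "last R \<notin> F"
    "\<And>u v. u \<in> S \<Longrightarrow> v \<in> set (tl R) \<Longrightarrow> adj u v \<Longrightarrow> adj (hd R) v"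
proof -
  define P where "P p \<longleftrightarrow> ipath p \<and> hd p \<in> S \<and> set (tl p) \<subseteq> D \<and> last p \<in> F" for p
  have walk: "\<exists>p. P p \<and> length p \<le> length w"
    if w: "successively adj w" "w \<noteq> []" "hd w \<in> S" "set (tl w) \<subseteq> D" "last w \<in> F" for w
  proof -
    obtain p where p: "ipath p" "hd p = hd w" "last p = last w" "set p \<subseteq> set w" "length p \<le> length w"
      using shorten_walk[OF w(1,2)] by blast
    have "hd p \<notin> set (tl p)"
      using ipath_distinct[OF p(1)] ipath_nonempty[OF p(1)] by (cases p) auto
    then have "set (tl p) \<subseteq> set w - {hd w}"
      using p(2,4) ipath_nonempty[OF p(1)] list.set_sel(2)[of p] by fastforce
    also have "\<dots> \<subseteq> D" using w(2,4) set_hd_tl[of w] by auto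
    finally show ?thesis using p w unfolding P_def by auto
  qed
  obtain f where f: "f \<in> F" using F by blast
  obtain w where w: "successively adj w" "w \<noteq> []" "hd w = z" "last w = f" "set w \<subseteq> D"
    using conn_walk[OF D S(3)] F(1) f by blast
  have "\<exists>p. P p" using walk[of "s # w"] w S f by (auto simp: successively_Cons)
  then obtain p where p: "P p" and min: "\<And>p'. P p' \<Longrightarrow> length p \<le> length p'"
    using ex_has_least_nat[of P _ length] by blast
  have pne: "p \<noteq> []" using p ipath_nonempty by (auto simp: P_def)
  have succ: "successively adj r" if "ipath r" for r
    using that by (induction r rule: ipath.induct) auto
  have minw: "length p \<le> length w"
    if "successively adj w" "w \<noteq> []" "hd w \<in> S" "set (tl w) \<subseteq> D" "last w \<in> F" for w
    using walk[OF that] min by force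
  define R where "R = butlast p"
  have "hd p \<noteq> last p" using p S(1) F(1) by (auto simp: P_def)
  then have Rne: "R \<noteq> []" using pne by (cases p) (auto simp: R_def split: if_splits)
  have pR: "p = R @ [last p]" using pne by (simp add: R_def)
  have ipR: "ipath R" using ipath_prefix[of R "[last p]"] p pR Rne by (simp add: P_def)
  have hdR: "hd R = hd p" using pR Rne by (metis hd_append2)
  have tlR: "set (tl R) \<subseteq> D" using p pR Rne by (metis P_def Un_subset_iff set_append tl_append2)
  have lenp: "length p = Suc (length R)" using pR by (metis length_append_singleton)
  have splitR: "R = us @ v # vs \<Longrightarrow> successively adj (us @ [v])" for us v vs
    using succ[OF ipR] by (auto simp: successively_append_iff)
  have hdSR: "hd R \<in> S" using p hdR by (simp add: P_def)
  have nF: "v \<notin> F" if "v \<in> set R" for v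
  proof
    assume v: "v \<in> F"
    obtain us vs where R: "R = us @ v # vs" using \<open>v \<in> set R\<close> by (meson split_list)
    have "length p \<le> length (us @ [v])"
    proof (rule minw)
      show "hd (us @ [v]) \<in> S" using hdSR R by (cases us) auto
      show "set (tl (us @ [v])) \<subseteq> D" using tlR R by (cases us) auto
    qed (use splitR[OF R] v in auto)
    then show False using lenp R by simp
  qed
  show thesis
  proof (rule that[of R])
    show "\<exists>v\<in>F. adj (last R) v"
      using p pR Rne succ[of p] unfolding P_def by (metis append_is_Nil_conv list.sel(1) not_Cons_self2 successively_append_iff)
    show "last R \<notin> F" using nF Rne by simp
    show "anti (set (butlast R)) F"
      unfolding anti_def
    proof (intro ballI conjI)
      fix v g assume v: "v \<in> set (butlast R)" and g: "g \<in> F"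
      show "v \<noteq> g" using nF v g in_set_butlastD by metis
      obtain us vs where b: "butlast R = us @ v # vs" using v by (meson split_list)
      then obtain e where R: "R = us @ v # vs @ [e]" using Rne by (metis append.assoc append_Cons append_butlast_last_id)
      show "\<not> adj v g"
      proof
        assume "adj v g"
        have "length p \<le> length (us @ [v, g])"
        proof (rule minw)
          show "successively adj (us @ [v, g])"
            using splitR[OF R] \<open>adj v g\<close> by (auto simp: successively_append_iff)
          show "hd (us @ [v, g]) \<in> S" using hdSR R by (cases us) auto
          show "set (tl (us @ [v, g])) \<subseteq> D" using tlR R g F(1) by (cases us) auto
        qed (use g in auto)
        moreover have "length R = length (us @ v # vs @ [e])" using R by simp
        ultimately show False using lenp by simp
      qed
    qed
    \<comment> \<open>A walk that starts at \<open>u\<close> and enters the path at \<open>v\<close>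
      skips \<open>us\<close>, so minimality forces \<open>us = []\<close>.\<close>
    show "adj (hd R) v" if uv: "u \<in> S" "v \<in> set (tl R)" "adj u v" for u v
    proof -
      obtain us vs where t: "tl R = us @ v # vs" using uv by (meson split_list)
      have R: "R = hd R # us @ v # vs" using t Rne by (metis list.collapse)
      have "length p \<le> length (u # v # vs @ [last p])"
      proof (rule minw)
        have "successively adj p" using succ p by (simp add: P_def)
        moreover have "p = (hd R # us) @ (v # vs @ [last p])" using pR R by (metis append.assoc append_Cons)
        ultimately have "successively adj ((hd R # us) @ (v # vs @ [last p]))" by metis
        then have "successively adj (v # vs @ [last p])" by (simp only: successively_append_iff)
        then show "successively adj (u # v # vs @ [last p])" using uv by simp
        have "last p \<in> D" using p F(1) by (auto simp: P_def)
        then show "set (tl (u # v # vs @ [last p])) \<subseteq> D" using tlR t by simp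
      qed (use uv p in \<open>auto simp: P_def\<close>)
      moreover have "length R = length (hd R # us @ v # vs)" using R by simp
      ultimately have "us = []" using lenp by simp
      then show ?thesis using succ[OF ipR] R by (metis append_Nil successively.simps(3))
    qed
  qed (use ipR hdSR tlR in auto)
qed

end

section \<open>Extending the rope by one link\<close>

text \<open>The rope is built inside the level \<open>C\<close> of a breadth-first search, with the level \<open>W\<close> of
  parents and the level \<open>A1\<close> of grandparents above it, and everything higher up in \<open>A0\<close>. The rope
  starts at \<open>a\<close>, and it will be closed through the parent \<open>pa\<close> of \<open>a\<close>.\<close>

locale layers = girth15 +
  fixes A0 A1 W C :: "'a set" and a pa :: 'a
  assumes fin: "finite C"
    and C_W: "c \<in> C \<Longrightarrow> \<exists>b\<in>W. adj c b"
    and W_A1: "b \<in> W \<Longrightarrow> \<exists>p\<in>A1. adj b p"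
    and A1_A0: "p \<in> A1 \<Longrightarrow> \<exists>u\<in>A0. adj p u"
    and conn_A0: "conn A0"
    and anti_A0: "anti A0 (W \<union> C)"
    and anti_A1: "anti A1 C"
    and disj: "W \<inter> C = {}" "A1 \<inter> W = {}"
    and a: "a \<in> W" "pa \<in> A1" "adj a pa"
begin

text \<open>The rope has been built up to \<open>q\<close>; \<open>A\<close> collects its earlier vertices. From \<open>q\<close> the path \<open>R\<close>
  leads to the region \<open>F\<close>. The parents and grandparents of \<open>F\<close> have no neighbours in \<open>A\<close>,
  whereas nothing is known yet about those of \<open>R\<close>.\<close>

definition rope_state :: "'a \<Rightarrow> 'a list \<Rightarrow> 'a set \<Rightarrow> 'a set \<Rightarrow> 'a set \<Rightarrow> bool" where
  "rope_state q R F A Qs \<longleftrightarrow>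
     ipath R \<and> hd R = q \<and> set (tl R) \<subseteq> C \<and> (q \<in> C \<or> q = a) \<and>
     conn F \<and> F \<subseteq> C \<and> (\<exists>z\<in>F. adj (last R) z) \<and> anti (set (butlast R)) F \<and> last R \<notin> F \<and>
     anti A (set (tl R) \<union> F) \<and> A \<subseteq> C \<union> W \<and>
     q \<in> Qs \<and> a \<in> Qs \<and> (\<forall>q'\<in>Qs. \<forall>f\<in>F. \<not> near 5 q' f) \<and>
     (\<forall>f\<in>F. \<forall>b\<in>W. adj f b \<longrightarrow> b \<notin> A \<and> (\<forall>v\<in>A. \<not> adj b v) \<and>
        (\<forall>p\<in>A1. adj b p \<longrightarrow> (\<forall>v\<in>A. \<not> adj p v))) \<and>
     (\<forall>v\<in>A \<inter> W. v = a \<or> \<not> adj pa v)"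

text \<open>Going through \<open>y\<close> changes the parity of the induced path from \<open>q\<close> to \<open>x\<close>, and vice versa.\<close>

definition fork :: "'a \<Rightarrow> 'a list \<Rightarrow> 'a list \<Rightarrow> 'a \<Rightarrow> 'a \<Rightarrow> 'a set \<Rightarrow> bool" where
  "fork q X Y x y D \<longleftrightarrow>
     hd X = q \<and> hd Y = q \<and> last X = x \<and> last Y = y \<and> ipath (X @ [y]) \<and> ipath (Y @ [x]) \<and>
     length X \<ge> 2 \<and> length Y \<ge> 2 \<and> even (length X + length Y) \<and> adj x y \<and> x \<notin> D \<and> y \<notin> D \<and>
     conn D \<and> anti (set X \<union> set Y - {x, y}) D \<and> (\<exists>z\<in>D. adj x z)"

text \<open>The sets of the colouring process are the siblings of the vertices of the fork. In case of a
  conflict between siblings of \<open>X\<close> and \<open>Y\<close>, two parents yield a new fork.\<close>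

lemma clean_fork:
  assumes st: "rope_state q R F A Qs" and fk: "fork q X Y x y D"
    and XY: "set (tl X) \<union> set (tl Y) \<subseteq> set (tl R) \<union> F" and xyF: "x \<in> F" "y \<in> F"
    and DF: "D \<subseteq> F" and big: "\<not> colr (k + 5) D"
  obtains X' Y' x' y' D' E where "fork q X' Y' x' y' D'" "x' \<in> F" "y' \<in> F" "D' \<subseteq> F"
    "conn E" "E \<subseteq> D'" "\<not> colr (k + 2) E"
    "set (tl X') \<union> set (tl Y') \<subseteq> C \<union> W" "anti A (set (tl X') \<union> set (tl Y'))"
    "\<And>v. v \<in> set X' \<union> set Y' \<Longrightarrow> near 2 x' v \<or> v = q \<or>
       (v \<in> C \<and> (\<forall>d\<in>E. \<forall>b\<in>W. adj d b \<longrightarrow> \<not> adj b v))"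
    "\<And>v. v \<in> set (tl X') \<union> set (tl Y') \<Longrightarrow> v \<in> W \<Longrightarrow> \<not> adj pa v"
proof -
  have FC: "F \<subseteq> C" and AF: "anti A (set (tl R) \<union> F)" and RC: "set (tl R) \<subseteq> C"
    and far: "\<And>f. f \<in> F \<Longrightarrow> \<not> near 5 q f" "\<And>f. f \<in> F \<Longrightarrow> \<not> near 5 a f"
    and par: "\<And>f b. f \<in> F \<Longrightarrow> b \<in> W \<Longrightarrow> adj f b \<Longrightarrow> b \<notin> A \<and> (\<forall>v\<in>A. \<not> adj b v)"
    using st unfolding rope_state_def by auto
  have X: "hd X = q" "last X = x" "ipath (X @ [y])" "length X \<ge> 2"
    and Y: "hd Y = q" "last Y = y" "ipath (Y @ [x])" "length Y \<ge> 2"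
    and xy: "even (length X + length Y)" "adj x y" "x \<notin> D" "y \<notin> D" "conn D"
      "anti (set X \<union> set Y - {x, y}) D" "\<exists>z\<in>D. adj x z"
    using fk unfolding fork_def by auto
  have near1: "near 1 u v" if "adj u v" for u v
    using near_step[OF near_refl[of 0 u] that] by simp
  have near2: "near 2 u v" if "adj u w" "adj w v" for u v w
    using near_step[OF near1[OF that(1)] that(2)] by (simp add: numeral_2_eq_2)
  have near3: "near 3 u v" if "adj u w" "adj w z" "adj z v" for u v w z
    using near_step[OF near2[OF that(1,2)] that(3)] by (simp add: numeral_3_eq_3 numeral_2_eq_2)
  have X_eq: "butlast X = q # tl (butlast X)" "X = q # tl (butlast X) @ [x]"
    using X by (cases X; cases "tl X" rule: rev_cases; auto split: if_splits)+
  have Y_eq: "butlast Y = q # tl (butlast Y)" "Y = q # tl (butlast Y) @ [y]"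
    using Y by (cases Y; cases "tl Y" rule: rev_cases; auto split: if_splits)+
  \<comment> \<open>Inner vertices of \<open>X\<close>, then those of \<open>Y\<close>. In this
    order the path from \<open>q\<close> to \<open>zs ! t\<close> along its branch uses, besides
    \<open>q\<close>, only indices up to \<open>t\<close>.\<close>
  define zs where "zs = tl (butlast X) @ tl (butlast Y)"
  define N where "N = length zs"
  have setXY: "set X \<union> set Y = insert q (insert x (insert y (set zs)))"
    by (subst X_eq(2), subst Y_eq(2)) (auto simp: zs_def)
  have dist: "distinct (X @ [y])" "distinct (Y @ [x])" using X(3) Y(3) ipath_distinct by blast+
  have bl: "set (butlast X) \<union> set (butlast Y) \<subseteq> set X \<union> set Y - {x, y}"
  proof -
    have "x \<notin> set (butlast X)" "y \<notin> set (butlast Y)"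
      using dist X_eq Y_eq by (metis append_Cons distinct_append not_distinct_conv_prefix append.assoc)+
    then show ?thesis using dist by (auto dest: in_set_butlastD)
  qed
  have zs_sub: "insert q (set zs) \<subseteq> set X \<union> set Y - {x, y}"
    using bl by (subst (asm) X_eq(1), subst (asm) Y_eq(1)) (auto simp: zs_def)
  have zsC: "set zs \<subseteq> C"
    using XY FC RC by (subst (asm) X_eq(2), subst (asm) Y_eq(2)) (auto simp: zs_def)
  have ipX: "ipath (butlast X)" using X_eq X(3) ipath_prefix[of "butlast X" "[x, y]"]
    by (metis append.assoc append_Cons append_Nil list.distinct(1))
  have ipY: "ipath (butlast Y)" using Y_eq Y(3) ipath_prefix[of "butlast Y" "[y, x]"]
    by (metis append.assoc append_Cons append_Nil list.distinct(1))
  have "\<exists>P. ipath P \<and> hd P = q \<and> last P = zs ! t \<and> set P \<subseteq> insert q (set (take (Suc t) zs))"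
    if t: "t < N" for t
  proof (cases "t < length (tl (butlast X))")
    case True
    have "take (Suc (Suc t)) (butlast X) = q # take (Suc t) (tl (butlast X))"
      by (subst X_eq(1)) simp
    then have ip: "ipath (q # take (Suc t) (tl (butlast X)))"
      using ipath_take[OF ipX, of "Suc (Suc t)"] by simp
    show ?thesis
      using ip True
      by (intro exI[of _ "q # take (Suc t) (tl (butlast X))"])
        (auto simp: zs_def nth_append take_Suc_conv_app_nth)
  next
    case False
    define i where "i = t - length (tl (butlast X))"
    have i: "i < length (tl (butlast Y))" "zs ! t = tl (butlast Y) ! i"
      "take (Suc t) zs = tl (butlast X) @ take (Suc i) (tl (butlast Y))"
      using False t by (auto simp: i_def N_def zs_def nth_append Suc_diff_le)
    have "take (Suc (Suc i)) (butlast Y) = q # take (Suc i) (tl (butlast Y))"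
      by (subst Y_eq(1)) simp
    then have ip: "ipath (q # take (Suc i) (tl (butlast Y)))"
      using ipath_take[OF ipY, of "Suc (Suc i)"] by simp
    show ?thesis
      using ip i
      by (intro exI[of _ "q # take (Suc i) (tl (butlast Y))"]) (auto simp: take_Suc_conv_app_nth)
  qed
  then obtain pre where pre: "\<And>t. t < N \<Longrightarrow> ipath (pre t)" "\<And>t. t < N \<Longrightarrow> hd (pre t) = q"
    "\<And>t. t < N \<Longrightarrow> last (pre t) = zs ! t"
    "\<And>t. t < N \<Longrightarrow> set (pre t) \<subseteq> insert q (set (take (Suc t) zs))" by metis
  have pre_idx: "v = q \<or> (\<exists>j\<le>t. j < N \<and> v = zs ! j)" if "t < N" "v \<in> set (pre t)" for v t
  proof -
    have "v = q \<or> v \<in> set (take (Suc t) zs)" using pre(4) that by blast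
    then show ?thesis using that(1) by (auto simp: in_set_conv_nth N_def less_Suc_eq_le)
  qed
  have pre_anti: "v \<noteq> d" "\<not> adj v d" if "t < N" "v \<in> set (pre t)" "d \<in> D" for v t d
  proof -
    have "v \<in> insert q (set zs)" using pre_idx[OF that(1,2)] by (auto simp: N_def)
    then show "v \<noteq> d" "\<not> adj v d" using zs_sub xy(6) that(3) unfolding anti_def by blast+
  qed
  define B where "B t = (if t < N then {d \<in> D. \<exists>b\<in>W. adj b d \<and> adj b (zs ! t)} else {})" for t
  \<comment> \<open>When \<open>v\<close> is deleted first by \<open>zs ! i\<close>, their common
    parent \<open>b\<close> sees no earlier vertex of \<open>pre i\<close>, by minimality of
    \<open>i\<close>, and does not see \<open>q\<close>, by distance. So \<open>pre i\<close> can be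
    prolonged through \<open>b\<close> and \<open>v\<close> to any neighbour of \<open>v\<close> in
    \<open>D\<close>.\<close>
  have orphan: "\<exists>b\<in>W. adj b v \<and> adj b (zs ! i) \<and> (\<forall>u\<in>D. adj v u \<longrightarrow> ipath (pre i @ [b, v, u]))"
    if i: "i < N" and v: "v \<in> B i" and first: "\<And>j. j < i \<Longrightarrow> v \<notin> B j" for i v
  proof -
    obtain b where b: "b \<in> W" "adj b v" "adj b (zs ! i)" and vD: "v \<in> D"
      using v i by (auto simp: B_def)
    have vF: "v \<in> F" using vD DF by blast
    have bC: "b \<notin> C" using b(1) disj by blast
    have ne: "pre i \<noteq> []" using pre(1)[OF i] ipath_nonempty by blast
    have q: "\<not> adj b q" "b \<noteq> q"
      using far(1)[OF vF] near_mono[of _ q v 5] near2[of q b v] near1[of b v] b(2) adj_sym by force+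
    have p1: "ipath (pre i @ [b])"
    proof (rule ipath_snoc[OF pre(1)[OF i]])
      show "b \<notin> set (pre i)"
      proof
        assume "b \<in> set (pre i)"
        then obtain j where "j < N" "b = zs ! j" using pre_idx[OF i] q by blast
        then have "b \<in> set zs" by (simp add: N_def)
        then show False using zsC bC by blast
      qed
      show "adj (last (pre i)) b" using pre(3)[OF i] b(3) adj_sym by simp
      fix z assume z: "z \<in> set (butlast (pre i))"
      have "z \<noteq> last (pre i)"
        using ipath_distinct[OF pre(1)[OF i]] z ne
        by (metis append_butlast_last_id disjoint_iff distinct_append list.set_intros(1))
      then have "z = q \<or> (\<exists>j<i. j < N \<and> z = zs ! j)"
        using pre_idx[OF i in_set_butlastD[OF z]] pre(3)[OF i] by (metis le_neq_implies_less)
      then show "\<not> adj z b"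
        using q first b vD adj_sym unfolding B_def by fastforce
    qed
    have p2: "ipath (pre i @ [b, v])"
    proof -
      have "ipath ((pre i @ [b]) @ [v])"
        by (rule ipath_snoc[OF p1]) (use pre_anti[OF i _ vD] b vF FC bC in auto)
      then show ?thesis by simp
    qed
    have "ipath (pre i @ [b, v, u])" if u: "u \<in> D" "adj v u" for u
    proof -
      have "ipath ((pre i @ [b, v]) @ [u])"
      proof (rule ipath_snoc[OF p2])
        show "u \<notin> set (pre i @ [b, v])"
          using pre_anti[OF i _ u(1)] u DF FC bC adj_irrefl by auto
        show "adj (last (pre i @ [b, v])) u" using u by simp
        fix z assume "z \<in> set (butlast (pre i @ [b, v]))"
        then have "z \<in> set (pre i) \<or> z = b" by (auto simp: butlast_append)
        then show "\<not> adj z u" using pre_anti[OF i _ u(1)] no_triangle[of b v u] b u by blast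
      qed
      then show ?thesis by simp
    qed
    then show ?thesis using b by blast
  qed
  \<comment> \<open>Siblings of one vertex are reached from it by walks of length 2, so an edge
    between them would close a walk of length 5.\<close>
  have stable: "\<not> adj u v" if "t < N" "u \<in> B t \<inter> D" "v \<in> B t \<inter> D" for t u v
  proof -
    have two: "(adj ^^ 2) (zs ! t) w" if w: "w \<in> B t" for w
    proof -
      obtain b where "adj b w" "adj b (zs ! t)" using w \<open>t < N\<close> by (auto simp: B_def)
      then show ?thesis using adj_sym by (auto simp: numeral_2_eq_2)
    qed
    show ?thesis using walks_not_adj[of 2 "zs ! t" u v] two that by simp
  qed
  have AX: "anti A (set (tl X) \<union> set (tl Y))" using AF XY unfolding anti_def by blast
  have clean: "\<forall>d\<in>E. \<forall>b\<in>W. adj d b \<longrightarrow> \<not> adj b (zs ! j)"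
    if "j < N" "E \<subseteq> D" "E \<inter> B j = {}" for j E
  proof -
    have "B j = {d \<in> D. \<exists>b\<in>W. adj b d \<and> adj b (zs ! j)}" using that(1) by (simp add: B_def)
    then show ?thesis using that(2,3) adj_sym by blast
  qed
  show thesis
  \<comment> \<open>A sibling of \<open>zs ! t\<close> is two steps further along than
    \<open>zs ! t\<close> itself, so the parity of \<open>pre t\<close> is also that of the path to
    the sibling.\<close>
  proof (rule colouring_process[of D "k + 5" "\<lambda>t. length (pre t) mod 2" N B])
    fix E assume E: "iscomp E (D - (\<Union>s<N. B s))" "\<not> colr (k + 5 - 2) E"
    show thesis
    \<comment> \<open>The fork survives unchanged. \<open>D\<close> is kept beside its clean part
      \<open>E\<close>, because only \<open>D\<close> is known to contain a neighbour of
      \<open>x\<close>.\<close>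
    proof (rule that[of X Y x y D E])
      show "conn E" "E \<subseteq> D" using E by (auto simp: iscomp_def)
      show "\<not> colr (k + 2) E" using E(2) colr_mono[of "k + 2" E E "k + 5 - 2"] by auto
      show "set (tl X) \<union> set (tl Y) \<subseteq> C \<union> W" using XY RC FC by blast
      show "\<not> adj pa v" if "v \<in> set (tl X) \<union> set (tl Y)" "v \<in> W" for v
        using that XY RC FC disj by blast
      fix v assume "v \<in> set X \<union> set Y"
      then consider "v = x" | "v = y" | "v = q" | "v \<in> set zs" using setXY by blast
      then show "near 2 x v \<or> v = q \<or> (v \<in> C \<and> (\<forall>d\<in>E. \<forall>b\<in>W. adj d b \<longrightarrow> \<not> adj b v))"
      proof cases
        case 4
        then obtain j where j: "j < N" "v = zs ! j" by (auto simp: in_set_conv_nth N_def)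
        have "E \<inter> B j = {}" "E \<subseteq> D" using E(1) j by (auto simp: iscomp_def)
        then show ?thesis using clean[of j E] j zsC 4 by blast
      qed (use near_refl near_mono[OF near1[OF xy(2)], of 2] in auto)
    qed (use fk xyF DF AX in auto)
  next
    fix t x' y' E
    assume t: "t < N" and x': "x' \<in> B t \<inter> D - (\<Union>s<t. B s)" and y': "y' \<in> (\<Union>s<t. B s) \<inter> D"
      and xy': "adj x' y'"
      and par': "length (pre (LEAST s. y' \<in> B s)) mod 2 = length (pre t) mod 2"
      and E: "iscomp E (D - (\<Union>s<Suc t. B s))" "\<not> colr (k + 5 - 3) E" "\<exists>z\<in>E. adj x' z"
    define s where "s = (LEAST s. y' \<in> B s)"
    obtain s0 where s0: "s0 < t" "y' \<in> B s0" using y' by blast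
    have s: "y' \<in> B s" "s < t" "\<And>j. j < s \<Longrightarrow> y' \<notin> B j"
      unfolding s_def using s0 by (auto intro: LeastI dest: not_less_Least intro: le_less_trans[OF Least_le])
    have sN: "s < N" using s t by simp
    obtain b where b: "b \<in> W" "adj b x'" "adj b (zs ! t)" "ipath (pre t @ [b, x', y'])"
      using orphan[OF t, of x'] x' y' xy' by blast
    obtain b2 where b2: "b2 \<in> W" "adj b2 y'" "adj b2 (zs ! s)" "ipath (pre s @ [b2, y', x'])"
    proof -
      obtain c where "c \<in> W" "adj c y'" "adj c (zs ! s)" "\<forall>u\<in>D. adj y' u \<longrightarrow> ipath (pre s @ [c, y', u])"
        using orphan[OF sN s(1) s(3)] by blast
      then show thesis using that[of c] x' adj_sym[OF xy'] by blast
    qed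
    have ED: "E \<subseteq> D" "conn E" and EB: "\<And>j. j \<le> t \<Longrightarrow> E \<inter> B j = {}"
      using E(1) by (auto simp: iscomp_def)
    have ne: "pre t \<noteq> []" "pre s \<noteq> []" using pre(1) t sN ipath_nonempty by blast+
    have x'F: "x' \<in> F" "y' \<in> F" using x' y' DF by auto
    have nadj: "b \<noteq> d \<and> \<not> adj b d \<and> b2 \<noteq> d \<and> \<not> adj b2 d" if "d \<in> E" for d
    proof -
      have "d \<in> D" "d \<in> C" "d \<notin> B t" "d \<notin> B s" using that ED EB[of t] EB[of s] s(2) DF FC by auto
      then show ?thesis using b b2 t sN disj by (auto simp: B_def)
    qed
    \<comment> \<open>Apart from \<open>q\<close>, the new branches consist of vertices
      \<open>zs ! j\<close> with \<open>j \<le> t\<close>, whose siblings are absent from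
      \<open>E\<close>, and of four vertices within distance 2 of \<open>x'\<close>.\<close>
    have fk': "fork q (pre t @ [b, x']) (pre s @ [b2, y']) x' y' E"
      unfolding fork_def
    proof (intro conjI)
      show "hd (pre t @ [b, x']) = q" "hd (pre s @ [b2, y']) = q" using ne pre(2) t sN by simp_all
      have "even (length (pre s) + length (pre t))"
        using par' by (metis even_add even_iff_mod_2_eq_zero s_def)
      then show "even (length (pre t @ [b, x']) + length (pre s @ [b2, y']))" by simp
      show "x' \<notin> E" "y' \<notin> E" using EB[of t] EB[of s] x' s by auto
      show "anti (set (pre t @ [b, x']) \<union> set (pre s @ [b2, y']) - {x', y'}) E"
        unfolding anti_def
      proof (intro ballI)
        fix v d assume v: "v \<in> set (pre t @ [b, x']) \<union> set (pre s @ [b2, y']) - {x', y'}" and d: "d \<in> E"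
        have dD: "d \<in> D" using d ED by blast
        consider "v = b" | "v = b2" | "v \<in> set (pre t)" | "v \<in> set (pre s)" using v by auto
        then show "v \<noteq> d \<and> \<not> adj v d"
          using nadj[OF d] pre_anti[OF t _ dD] pre_anti[OF sN _ dD] by cases auto
      qed
    qed (use b b2 xy' ED E in auto)
    have tlp: "set (tl (pre i @ [c, v])) \<subseteq> set zs \<union> {c, v}" if "i < N" for i c v
    proof -
      have d: "q \<notin> set (tl (pre i))"
        using ipath_distinct[OF pre(1)[OF that]] pre(1,2)[OF that] by (cases "pre i") auto
      have "set (tl (pre i)) \<subseteq> insert q (set zs)"
        using pre(4)[OF that] set_take_subset[of "Suc i" zs] list.set_sel(2)[of "pre i"]
          ipath_nonempty[OF pre(1)[OF that]] by blast
      then show ?thesis using d ipath_nonempty[OF pre(1)[OF that]] by auto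
    qed
    have tl_sub: "set (tl (pre t @ [b, x'])) \<union> set (tl (pre s @ [b2, y'])) \<subseteq> set zs \<union> {b, x', b2, y'}"
      using tlp[OF t, of b x'] tlp[OF sN, of b2 y'] by blast
    show thesis
    proof (rule that[OF fk', of E])
      show "\<not> colr (k + 2) E" using E(2) by simp
      show "set (tl (pre t @ [b, x'])) \<union> set (tl (pre s @ [b2, y'])) \<subseteq> C \<union> W"
        using tl_sub zsC b b2 x'F FC by blast
      have "set zs \<subseteq> set (tl X) \<union> set (tl Y)"
        by (subst X_eq(2), subst Y_eq(2)) (auto simp: zs_def)
      then have "anti A (set zs)" using AX unfolding anti_def by blast
      moreover have "anti A {b, x', b2, y'}"
      proof -
        have "c \<notin> A \<and> (\<forall>v\<in>A. \<not> adj v c)" if "f \<in> F" "c \<in> W" "adj c f" for c f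
          using par[OF that(1,2)] that(3) adj_sym by blast
        then have "anti A {b, b2}" using b b2 x'F unfolding anti_def by blast
        moreover have "anti A {x', y'}" using x'F AF unfolding anti_def by blast
        ultimately show ?thesis unfolding anti_def by blast
      qed
      ultimately have "anti A (set zs \<union> {b, x', b2, y'})" by (simp only: anti_Un2)
      then show "anti A (set (tl (pre t @ [b, x'])) \<union> set (tl (pre s @ [b2, y'])))"
        by (rule anti_mono[OF _ subset_refl tl_sub])
      show "\<not> adj pa v" if "v \<in> set (tl (pre t @ [b, x'])) \<union> set (tl (pre s @ [b2, y']))" "v \<in> W" for v
      proof
        assume pv: "adj pa v"
        have "v = b \<or> v = b2" using that tl_sub zsC x'F FC disj by blast
        \<comment> \<open>The walk from \<open>a\<close> through \<open>pa\<close> and the parent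
          \<open>v\<close> to one of \<open>x'\<close>, \<open>y'\<close>.\<close>
        then have "\<exists>f\<in>F. near 3 a f"
          using near3[OF a(3) pv] b b2 x'F by blast
        then show False using far(2) near_mono[of 3 a _ 5] by auto
      qed
      fix v assume "v \<in> set (pre t @ [b, x']) \<union> set (pre s @ [b2, y'])"
      then consider "v \<in> {b, x', b2, y'}" | "v \<in> set (pre t) \<union> set (pre s)" by auto
      then show "near 2 x' v \<or> v = q \<or> (v \<in> C \<and> (\<forall>d\<in>E. \<forall>b\<in>W. adj d b \<longrightarrow> \<not> adj b v))"
      proof cases
        case 1
        have "near 2 x' b" "near 2 x' y'" "near 2 x' b2" "near 2 x' x'"
          using near_mono[OF near1, of _ _ 2] near2[of x' y' b2] near_refl b b2 xy' adj_sym by auto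
        then show ?thesis using 1 by blast
      next
        case 2
        have "v = q \<or> (\<exists>j\<le>t. j < N \<and> v = zs ! j)"
        proof (cases "v \<in> set (pre t)")
          case True
          then show ?thesis using pre_idx[OF t] by blast
        next
          case False
          then have "v = q \<or> (\<exists>j\<le>s. j < N \<and> v = zs ! j)" using pre_idx[OF sN] 2 by blast
          moreover have "j \<le> t" if "j \<le> s" for j using that s(2) by simp
          ultimately show ?thesis by blast
        qed
        then consider "v = q" | j where "j \<le> t" "j < N" "v = zs ! j" by blast
        then show ?thesis
        proof cases
          case (2 j)
          have "v \<in> C" using 2 zsC by (auto simp: N_def)
          then show ?thesis using clean[OF 2(2) ED(1) EB[OF 2(1)]] 2(3) by blast
        qed simp
      qed
    qed (use x'F ED DF in auto)
  qed (use xy big stable in auto)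
qed


text \<open>Of the 8 colours, 3 go into finding a fork, 3 into cleaning it and 2 into the ball
  around \<open>x'\<close>. The next rope vertex is whichever of \<open>x'\<close> and
  \<open>y'\<close> begins the shortest path to the remaining region; the fork reaches either of
  them in both parities.\<close>

lemma rope_link:
  assumes st: "rope_state q R F A Qs" and big: "\<not> colr (k + 8) F"
  obtains q' R' F' Q1 Q2 where
    "ipath Q1" "hd Q1 = q" "last Q1 = q'" "even (length Q1)"
    "ipath Q2" "hd Q2 = q" "last Q2 = q'" "odd (length Q2)"
    "q' \<in> F" "anti A (set (tl Q1) \<union> set (tl Q2))"
    "rope_state q' R' F' (A \<union> (set Q1 \<union> set Q2 - {q'})) (insert q' Qs)" "\<not> colr k F'" "F' \<subseteq> F"
proof -
  have R: "ipath R" "hd R = q" "set (tl R) \<subseteq> C" "q \<in> C \<or> q = a" "anti (set (butlast R)) F"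
      "last R \<notin> F" "\<exists>z\<in>F. adj (last R) z" and F: "conn F" "F \<subseteq> C"
    and AF: "anti A (set (tl R) \<union> F)" and AC: "A \<subseteq> C \<union> W"
    and Qs: "q \<in> Qs" "a \<in> Qs" and far: "\<And>q' f. q' \<in> Qs \<Longrightarrow> f \<in> F \<Longrightarrow> \<not> near 5 q' f"
    and par: "\<And>f b. f \<in> F \<Longrightarrow> b \<in> W \<Longrightarrow> adj f b \<Longrightarrow> b \<notin> A \<and> (\<forall>v\<in>A. \<not> adj b v) \<and>
        (\<forall>p\<in>A1. adj b p \<longrightarrow> (\<forall>v\<in>A. \<not> adj p v))"
    and pa: "\<And>v. v \<in> A \<Longrightarrow> v \<in> W \<Longrightarrow> v = a \<or> \<not> adj pa v"
    using st unfolding rope_state_def by auto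
  have finF: "finite F" using F(2) fin by (rule finite_subset)
  obtain X0 Y0 x y D where fk0: "hd X0 = last R" "hd Y0 = last R" "last X0 = x" "last Y0 = y"
    "ipath (X0 @ [y])" "ipath (Y0 @ [x])" "length X0 = length Y0" "length X0 \<ge> 2"
    "set (tl X0) \<subseteq> F" "set (tl Y0) \<subseteq> F"
    "x \<in> F" "y \<in> F" "adj x y" "conn D" "D \<subseteq> F" "\<not> colr (k + 8 - 3) D" "x \<notin> D" "y \<notin> D"
    "anti (set X0 \<union> set Y0 - {x, y}) D" "\<exists>z\<in>D. adj x z"
    by (rule fork_exists[OF F(1) finF R(6) R(7) big]) (simp, rule that)
  have Rne: "R \<noteq> []" using R(1) ipath_nonempty by blast
  \<comment> \<open>The search starts at \<open>last R\<close>. Prefixing a branch with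
    \<open>R\<close> keeps it induced, since no other vertex of \<open>R\<close> has a neighbour in
    \<open>F\<close>.\<close>
  have ext: "ipath (R @ tl Z @ [v])" if "ipath (Z @ [v])" "hd Z = last R" "set (tl Z) \<subseteq> F" "v \<in> F" "length Z \<ge> 2"
    for Z v
  proof -
    have Z: "tl (Z @ [v]) = tl Z @ [v]" "hd (Z @ [v]) = last R" using that by (cases Z; simp)+
    show ?thesis
      using ipath_append[OF R(1) that(1)] Z R(5) that(3,4) unfolding anti_def by auto
  qed
  have lastZ: "last (R @ tl Z) = last Z" "length (R @ tl Z) + 1 = length R + length Z"
    "hd (R @ tl Z) = q" "length (R @ tl Z) \<ge> 2" "set (tl (R @ tl Z)) = set (tl R) \<union> set (tl Z)"
    if "length Z \<ge> 2" for Z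
    using that Rne R(2) by (cases Z; auto simp: neq_Nil_conv Suc_le_length_iff)+
  have lR: "last R \<in> set X0" using fk0(1,8) by (cases X0) auto
  have fk1: "fork q (R @ tl X0) (R @ tl Y0) x y D"
    unfolding fork_def
  proof (intro conjI)
    show "ipath ((R @ tl X0) @ [y])" "ipath ((R @ tl Y0) @ [x])" using ext[of X0 y] ext[of Y0 x] fk0 by simp_all
    show "even (length (R @ tl X0) + length (R @ tl Y0))" using fk0(7) by simp
    have "v \<noteq> d \<and> \<not> adj v d" if "v \<in> set R" "d \<in> D" for v d
    proof (cases "v = last R")
      case True
      then have "v \<in> set X0 \<union> set Y0 - {x, y}" using lR R(6) fk0(11,12) by auto
      then show ?thesis using fk0(19) that(2) unfolding anti_def by blast
    next
      case False
      then have "v \<in> set (butlast R)" using that(1) set_butlast_last[OF Rne] by blast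
      then show ?thesis using R(5) that(2) fk0(15) unfolding anti_def by blast
    qed
    then have "anti (set R) D" unfolding anti_def by blast
    then have "anti (set R \<union> (set X0 \<union> set Y0 - {x, y})) D" using fk0(19) by (simp only: anti_Un1)
    moreover have "set (tl Z) \<subseteq> set Z" for Z :: "'a list" by (cases Z) auto
    then have "set (R @ tl X0) \<union> set (R @ tl Y0) - {x, y} \<subseteq> set R \<union> (set X0 \<union> set Y0 - {x, y})" by auto
    ultimately show "anti (set (R @ tl X0) \<union> set (R @ tl Y0) - {x, y}) D"
      by (rule anti_mono[OF _ _ subset_refl])
  qed (use fk0 lastZ[of X0] lastZ[of Y0] in auto)
  have tl1: "set (tl (R @ tl X0)) \<union> set (tl (R @ tl Y0)) \<subseteq> set (tl R) \<union> F"
    using lastZ(5)[of X0] lastZ(5)[of Y0] fk0(7-10) by auto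
  have big1: "\<not> colr (k + 5) D" using fk0(16) by (simp add: add.commute)
  obtain X Y x' y' D' E where fk: "fork q X Y x' y' D'" and xF: "x' \<in> F" "y' \<in> F"
    and D': "D' \<subseteq> F" and E: "conn E" "E \<subseteq> D'" "\<not> colr (k + 2) E"
    and tlC: "set (tl X) \<union> set (tl Y) \<subseteq> C \<union> W" and AX: "anti A (set (tl X) \<union> set (tl Y))"
    and loc: "\<And>v. v \<in> set X \<union> set Y \<Longrightarrow> near 2 x' v \<or> v = q \<or>
       (v \<in> C \<and> (\<forall>d\<in>E. \<forall>b\<in>W. adj d b \<longrightarrow> \<not> adj b v))"
    and paX: "\<And>v. v \<in> set (tl X) \<union> set (tl Y) \<Longrightarrow> v \<in> W \<Longrightarrow> \<not> adj pa v"
    by (rule clean_fork[OF st fk1 tl1 fk0(11,12,15) big1]) (rule that)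
  have X: "hd X = q" "last X = x'" "ipath (X @ [y'])" "length X \<ge> 2"
    and Y: "hd Y = q" "last Y = y'" "ipath (Y @ [x'])" "length Y \<ge> 2"
    and xy: "even (length X + length Y)" "adj x' y'" "x' \<notin> D'" "y' \<notin> D'" "conn D'"
      "anti (set X \<union> set Y - {x', y'}) D'" "\<exists>z\<in>D'. adj x' z"
    using fk unfolding fork_def by auto
  have ne: "X \<noteq> []" "Y \<noteq> []" using X(4) Y(4) by auto
  have xyin: "x' \<in> set X" "y' \<in> set Y" using X(2) Y(2) ne last_in_set by blast+
  obtain F' where F': "iscomp F' {v \<in> E. \<not> near 6 x' v}" "\<not> colr k F'"
    using remove_ball[OF E(3), of x'] by blast
  have F'E: "F' \<subseteq> E" "conn F'" "F' \<noteq> {}" and F'far: "\<And>f. f \<in> F' \<Longrightarrow> \<not> near 6 x' f"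
    using F'(1) by (auto simp: iscomp_def conn_def)
  have F'F: "F' \<subseteq> F" "F' \<subseteq> D'" using F'E E D' by auto
  have nears: "near (Suc n) x' w" if "near n x' v" "adj v w" for n v w
    using near_step that by blast
  have farxy: "\<not> adj u v" if "u \<in> {x', y'}" "v \<in> F'" for u v
    using that F'far[of v] near_mono[of "Suc 0" x' v 6] near_mono[of "Suc (Suc 0)" x' v 6] nears[OF near_refl, of v 0]
      nears[OF nears[OF near_refl xy(2)], of v 0] by auto
  \<comment> \<open>\<open>R'\<close> runs through \<open>D'\<close>, whose vertices need not be
    clean, while its target \<open>F'\<close> lies in the clean part \<open>E\<close>.\<close>
  obtain R' where R': "ipath R'" "hd R' \<in> {x', y'}" "set (tl R') \<subseteq> D'" "\<exists>v\<in>F'. adj (last R') v"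
    "anti (set (butlast R')) F'" "last R' \<notin> F'"
    "\<And>u v. u \<in> {x', y'} \<Longrightarrow> v \<in> set (tl R') \<Longrightarrow> adj u v \<Longrightarrow> adj (hd R') v"
  proof -
    obtain z where z: "z \<in> D'" "adj x' z" using xy(7) by blast
    show thesis
    proof (rule short_path[OF xy(5) _ _ z F'F(2) F'E(3) farxy])
      show "{x', y'} \<inter> D' = {}" "x' \<in> {x', y'}" using xy(3,4) by auto
    qed (assumption, assumption, rule that)
  qed
  define e where "e = hd R'"
  define e' where "e' = (if e = x' then y' else x')"
  have ee': "{e, e'} = {x', y'}" "adj e e'" "e \<noteq> e'"
    using R'(2) xy(2) adj_sym adj_irrefl by (auto simp: e_def e'_def)
  have exyF: "e \<in> F" "e' \<in> F" using ee'(1) xF by (auto simp: doubleton_eq_iff)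
  \<comment> \<open>One branch ends at \<open>e\<close>; the other ends at \<open>e'\<close> and is
    prolonged by the edge. As the branches agree in parity, the two resulting paths do not.\<close>
  obtain P1 P2 where P: "ipath P1" "ipath P2" "hd P1 = q" "hd P2 = q" "last P1 = e" "last P2 = e"
    "odd (length P1 + length P2)" "set P1 \<union> set P2 = set X \<union> set Y"
    "set (tl P1) \<union> set (tl P2) = set (tl X) \<union> set (tl Y) \<union> {e}"
  proof (cases "e = x'")
    case True
    show thesis
    proof (rule that[of X "Y @ [x']"])
      show "ipath X" using ipath_prefix X ne by blast
      show "set (tl X) \<union> set (tl (Y @ [x'])) = set (tl X) \<union> set (tl Y) \<union> {e}" using True ne by auto
    qed (use True X Y xy xyin ne in auto)
  next
    case False
    then have e: "e = y'" using R'(2) e_def by blast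
    show thesis
    proof (rule that[of Y "X @ [y']"])
      show "ipath Y" using ipath_prefix Y ne by blast
      show "set (tl Y) \<union> set (tl (X @ [y'])) = set (tl X) \<union> set (tl Y) \<union> {e}" using e ne by auto
    qed (use e X Y xy xyin ne in auto)
  qed
  obtain Q1 Q2 where Q: "ipath Q1" "hd Q1 = q" "last Q1 = e" "even (length Q1)"
    "ipath Q2" "hd Q2 = q" "last Q2 = e" "odd (length Q2)" "set Q1 \<union> set Q2 = set X \<union> set Y"
    "set (tl Q1) \<union> set (tl Q2) = set (tl X) \<union> set (tl Y) \<union> {e}"
  proof (cases "even (length P1)")
    case True
    then show thesis using that[of P1 P2] P by auto
  next
    case False
    then show thesis using that[of P2 P1] P by (auto simp: Un_commute)
  qed
  define A' where "A' = A \<union> (set Q1 \<union> set Q2 - {e})"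
  have XYq: "v = q \<or> v \<in> set (tl X) \<union> set (tl Y)" if "v \<in> set X \<union> set Y" for v
    using that by (simp only: set_hd_tl[OF ne(1)] set_hd_tl[OF ne(2)] X(1) Y(1)) blast
  have A'_cases: "v \<in> A \<or> v \<in> set X \<union> set Y - {x', y'} \<or> v = e'" if "v \<in> A'" for v
    using that Q(9) ee'(1) unfolding A'_def by blast
  show thesis
  proof (rule that[OF Q(1-8) exyF(1)])
    have "anti A {e}" using AF exyF(1) unfolding anti_def by blast
    then show "anti A (set (tl Q1) \<union> set (tl Q2))" using AX unfolding Q(10) by (simp only: anti_Un2)
    show "rope_state e R' F' (A \<union> (set Q1 \<union> set Q2 - {e})) (insert e Qs)"
      unfolding rope_state_def A'_def[symmetric]
    proof (intro conjI)
      show "e \<in> C \<or> e = a" using exyF F(2) by blast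
      show "set (tl R') \<subseteq> C" "F' \<subseteq> C" using R'(3) F'F D' F(2) by blast+
      show "anti A' (set (tl R') \<union> F')"
        unfolding anti_def
      proof (intro ballI)
        fix v w assume v: "v \<in> A'" and w: "w \<in> set (tl R') \<union> F'"
        have wD: "w \<in> D'" using w R'(3) F'F by blast
        consider "v \<in> A" | "v \<in> set X \<union> set Y - {x', y'}" | "v = e'" using A'_cases[OF v] by blast
        then show "v \<noteq> w \<and> \<not> adj v w"
        proof cases
          case 1
          then show ?thesis using AF wD D' unfolding anti_def by blast
        next
          case 2
          then show ?thesis using xy(6) wD unfolding anti_def by blast
        next
          case 3
          have "v \<in> {x', y'}" using 3 ee'(1) by blast
          \<comment> \<open>A contact of \<open>e'\<close> with the rest of \<open>R'\<close> would
            also be a contact of \<open>e\<close>, which gives a triangle.\<close>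
          moreover have False if "w \<in> set (tl R')" "adj v w"
            using R'(7)[OF \<open>v \<in> {x', y'}\<close> that] no_triangle[of e e' w] ee'(2) 3 that(2) by (simp add: e_def)
          ultimately show ?thesis using w wD xy(3,4) farxy[of v w] by blast
        qed
      qed
      show "A' \<subseteq> C \<union> W"
      proof
        fix v assume "v \<in> A'"
        then have "v \<in> A \<or> v \<in> set X \<union> set Y" unfolding A'_def using Q(9) by blast
        then have "v \<in> A \<or> v = q \<or> v \<in> set (tl X) \<union> set (tl Y)" using XYq by blast
        then show "v \<in> C \<union> W" using AC tlC R(4) a by blast
      qed
      show "\<forall>q'\<in>insert e Qs. \<forall>f\<in>F'. \<not> near 5 q' f"
      proof (intro ballI notI)
        fix q' f assume q': "q' \<in> insert e Qs" and f: "f \<in> F'" and n: "near 5 q' f"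
        have "q' = x' \<or> q' = y'" using q' far[of q' f] f n F'F ee'(1) by blast
        then have "near 6 x' f"
        proof
          assume "q' = y'"
          obtain m where "m \<le> 5" "(adj ^^ m) y' f" using n \<open>q' = y'\<close> unfolding near_def by blast
          then have "(adj ^^ Suc m) x' f" using xy(2) by (meson relpowp_Suc_I2)
          then show ?thesis unfolding near_def using \<open>m \<le> 5\<close> by (intro exI[of _ "Suc m"]) simp
        qed (use n near_mono[of 5 x' f 6] in auto)
        then show False using F'far f by blast
      qed
      show "\<forall>f\<in>F'. \<forall>b\<in>W. adj f b \<longrightarrow> b \<notin> A' \<and> (\<forall>v\<in>A'. \<not> adj b v) \<and>
              (\<forall>p\<in>A1. adj b p \<longrightarrow> (\<forall>v\<in>A'. \<not> adj p v))"
      proof (intro ballI impI)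
        fix f b assume f: "f \<in> F'" and b: "b \<in> W" "adj f b"
        have bf: "adj b f" using b adj_sym by blast
        have fF: "f \<in> F" using f F'F by blast
        have ok: "b \<noteq> v \<and> \<not> adj b v \<and> (\<forall>p\<in>A1. adj b p \<longrightarrow> \<not> adj p v)" if "v \<in> A'" for v
        proof -
          \<comment> \<open>Any interference joins \<open>v\<close> to \<open>f\<close> in at most
            three steps, the longest way leading through a grandparent and a parent of
            \<open>f\<close>. With distance at most 2 from \<open>c\<close> to \<open>v\<close>,
            this would bring \<open>f\<close> within distance 5 of \<open>c\<close>.\<close>
          have local_ok: ?thesis if "near 2 c v" "\<not> near 5 c f" for c
          proof -
            have n: "near 3 c w" if "adj v w" for w
              using near_step[OF \<open>near 2 c v\<close> that] by (simp add: numeral_3_eq_3 numeral_2_eq_2)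
            have n4: "near 4 c w" if "near 3 c u" "adj u w" for u w
              using near_step[OF that] by simp
            have n5: "near 5 c w" if "near 4 c u" "adj u w" for u w
              using near_step[OF that] by simp
            have "b \<noteq> v" using n[of f] near_mono[of 3 c f 5] bf that(2) by auto
            moreover have "\<not> adj b v" using n4[OF n bf] near_mono[of 4 c f 5] adj_sym that(2) by auto
            moreover have "\<not> adj p v" if "adj b p" for p
              using n5[OF n4[OF n] bf, of p] adj_sym that \<open>\<not> near 5 c f\<close> by blast
            ultimately show ?thesis by blast
          qed
          have "v \<in> A \<or> v \<in> set X \<union> set Y" using \<open>v \<in> A'\<close> unfolding A'_def using Q(9) by blast
          then consider "v \<in> A" | "near 2 x' v" | "v = q" | "v \<in> C" "\<forall>d\<in>E. \<forall>b\<in>W. adj d b \<longrightarrow> \<not> adj b v"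
            using loc by blast
          then show ?thesis
          proof cases
            case 1
            then show ?thesis using par[OF fF b] by blast
          next
            case 2
            then show ?thesis using local_ok[of x'] F'far[OF f] near_mono[of 5 x' f 6] by auto
          next
            case 3
            then show ?thesis using local_ok[of q] far[OF Qs(1) fF] near_refl[of 2 q] by blast
          next
            \<comment> \<open>Grandparents have no neighbours in \<open>C\<close>, so for such
              \<open>v\<close> it suffices that the parents are clean.\<close>
            case 4
            have "f \<in> E" using f F'E by blast
            then show ?thesis using 4 b disj anti_A1 unfolding anti_def by blast
          qed
        qed
        then show "b \<notin> A' \<and> (\<forall>v\<in>A'. \<not> adj b v) \<and> (\<forall>p\<in>A1. adj b p \<longrightarrow> (\<forall>v\<in>A'. \<not> adj p v))"
          by blast
      qed
      show "\<forall>v\<in>A' \<inter> W. v = a \<or> \<not> adj pa v"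
      proof
        fix v assume v: "v \<in> A' \<inter> W"
        then have "v \<in> A \<or> v \<in> set X \<union> set Y" unfolding A'_def using Q(9) by blast
        then show "v = a \<or> \<not> adj pa v" using pa paX XYq v R(4) disj by blast
      qed
    qed (use R' F'E Qs e_def in auto)
  qed (use F' F'F in auto)
qed

end

context layers
begin

section \<open>Building and closing the rope\<close>

text \<open>The initial 2 colours pay for the ball around \<open>a\<close>, which puts the first
  region far from \<open>a\<close>; there are no earlier rope vertices to avoid.\<close>

lemma rope_start:
  assumes C: "conn C" "\<not> colr (k + 2) C" "c \<in> C" "adj a c"
  obtains R F where "rope_state a R F {} {a}" "\<not> colr k F"
proof -
  obtain F where F: "iscomp F {v \<in> C. \<not> near 6 a v}" "\<not> colr k F"
    using remove_ball[OF C(2), of a] by blast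
  have FC: "F \<subseteq> C" "conn F" "F \<noteq> {}" and far: "\<And>f. f \<in> F \<Longrightarrow> \<not> near 6 a f"
    using F(1) by (auto simp: iscomp_def conn_def)
  have aC: "a \<notin> C" using a(1) disj by blast
  have nadj: "\<not> adj u v" if "u \<in> {a}" "v \<in> F" for u v
  proof
    assume "adj u v"
    then have "near (Suc 0) a v" using near_step[OF near_refl] that(1) by blast
    then show False using far[OF that(2)] near_mono[of "Suc 0" a v 6] by simp
  qed
  obtain R where R: "ipath R" "hd R \<in> {a}" "set (tl R) \<subseteq> C" "\<exists>v\<in>F. adj (last R) v"
    "anti (set (butlast R)) F" "last R \<notin> F"
  proof (rule short_path[OF C(1) _ _ C(3,4) FC(1,3) nadj])
    show "{a} \<inter> C = {}" "a \<in> {a}" using aC by auto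
  qed (assumption, assumption, rule that)
  have "rope_state a R F {} {a}"
    unfolding rope_state_def
  proof (intro conjI)
    show "\<forall>q'\<in>{a}. \<forall>f\<in>F. \<not> near 5 q' f" using far near_mono[of 5 a _ 6] by auto
  qed (use R FC in \<open>auto simp: anti_def\<close>)
  then show thesis using that F(2) by blast
qed

text \<open>The end \<open>q (Suc i)\<close> of link \<open>i\<close> is left out in the last clause
  because the next link starts there; as a vertex of that link it is separated from all later
  tails.\<close>

definition links :: "nat \<Rightarrow> (nat \<Rightarrow> 'a) \<Rightarrow> (nat \<Rightarrow> nat \<Rightarrow> 'a list) \<Rightarrow> bool" where
  "links n q Q \<longleftrightarrow>
     (\<forall>i<n. \<forall>j\<in>{1, 2}. ipath (Q i j) \<and> hd (Q i j) = q i \<and> last (Q i j) = q (Suc i)) \<and>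
     (\<forall>i<n. even (length (Q i 1)) \<and> odd (length (Q i 2))) \<and>
     (\<forall>m<n. \<forall>i<m. anti (set (Q i 1) \<union> set (Q i 2) - {q (Suc i)}) (set (tl (Q m 1)) \<union> set (tl (Q m 2))))"

text \<open>This becomes the set \<open>A\<close> of \<open>rope_state\<close> after
  \<open>n\<close> links.\<close>

definition old_verts :: "nat \<Rightarrow> (nat \<Rightarrow> 'a) \<Rightarrow> (nat \<Rightarrow> nat \<Rightarrow> 'a list) \<Rightarrow> 'a set" where
  "old_verts n q Q = (\<Union>i<n. set (Q i 1) \<union> set (Q i 2) - {q (Suc i)})"

text \<open>Iteration of \<open>rope_link\<close>, with \<open>k\<close> general in the induction so
  that 8 colours per later link can be held back. A new rope vertex lies in the old region, which
  has distance more than 5 from all earlier rope vertices; this yields condition (e).\<close>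

lemma rope_chain:
  assumes st: "rope_state a R0 F0 {} {a}" and big: "\<not> colr (8 * n + k) F0"
  shows "\<exists>q Q R F. q 0 = a \<and> links n q Q \<and> rope_state (q n) R F (old_verts n q Q) (q ` {..n}) \<and>
    \<not> colr k F \<and> (\<forall>m\<le>n. \<forall>i<m. \<not> near 5 (q i) (q m)) \<and> (\<forall>i. 0 < i \<and> i \<le> n \<longrightarrow> q i \<in> C)"
  using big
proof (induction n arbitrary: k)
  case 0
  then show ?case using st
    by (intro exI[of _ "\<lambda>_. a"] exI[of _ "\<lambda>_ _. []"] exI[of _ R0] exI[of _ F0])
      (simp add: links_def old_verts_def)
next
  case (Suc n)
  have "8 * Suc n + k = 8 * n + (k + 8)" by simp
  then have "\<not> colr (8 * n + (k + 8)) F0" using Suc.prems by metis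
  from Suc.IH[OF this] obtain q Q R F where IH: "q 0 = a" "links n q Q"
      "rope_state (q n) R F (old_verts n q Q) (q ` {..n})" "\<not> colr (k + 8) F"
      "\<forall>m\<le>n. \<forall>i<m. \<not> near 5 (q i) (q m)" "\<forall>i. 0 < i \<and> i \<le> n \<longrightarrow> q i \<in> C"
    by (elim exE conjE) (rule that)
  obtain q' R' F' Q1 Q2 where lk:
    "ipath Q1" "hd Q1 = q n" "last Q1 = q'" "even (length Q1)"
    "ipath Q2" "hd Q2 = q n" "last Q2 = q'" "odd (length Q2)"
    "q' \<in> F" "anti (old_verts n q Q) (set (tl Q1) \<union> set (tl Q2))"
    "rope_state q' R' F' (old_verts n q Q \<union> (set Q1 \<union> set Q2 - {q'})) (insert q' (q ` {..n}))"
    "\<not> colr k F'" "F' \<subseteq> F"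
    by (rule rope_link[OF IH(3,4)])
  define p where "p = q(Suc n := q')"
  define P where "P = Q(n := (\<lambda>j. if j = 1 then Q1 else Q2))"
  have p1: "p i = q i" if "i \<le> n" for i using that by (simp add: p_def)
  have p2: "p (Suc n) = q'" by (simp add: p_def)
  note p = p1 p2
  have P: "P i = Q i" if "i < n" for i using that by (simp add: P_def)
  have Pn: "P n 1 = Q1" "P n 2 = Q2" by (simp_all add: P_def)
  have old: "old_verts n p P = old_verts n q Q"
    unfolding old_verts_def using p P by (intro SUP_cong) auto
  have oldS: "old_verts (Suc n) p P = old_verts n q Q \<union> (set Q1 \<union> set Q2 - {q'})"
    using old Pn p by (auto simp: old_verts_def lessThan_Suc)
  have im: "p ` {..Suc n} = insert q' (q ` {..n})"
    using p by (auto simp: atMost_Suc image_iff)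
  have FC: "F \<subseteq> C" and far: "\<And>i f. i \<le> n \<Longrightarrow> f \<in> F \<Longrightarrow> \<not> near 5 (q i) f"
    using IH(3) unfolding rope_state_def by auto
  have "links (Suc n) p P"
    unfolding links_def
  proof (intro conjI allI impI ballI)
    fix i j :: nat assume i: "i < Suc n" and j: "j \<in> {1, 2}"
    have "ipath (P i j) \<and> hd (P i j) = p i \<and> last (P i j) = p (Suc i)"
    proof (cases "i = n")
      case True
      then show ?thesis using lk j Pn p by auto
    next
      case False
      then show ?thesis using IH(2) i j p P by (auto simp: links_def)
    qed
    then show "ipath (P i j)" "hd (P i j) = p i" "last (P i j) = p (Suc i)" by auto
  next
    fix i assume i: "i < Suc n"
    have "even (length (P i 1)) \<and> odd (length (P i 2))"
    proof (cases "i = n")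
      case True
      then show ?thesis using lk Pn by auto
    next
      case False
      then show ?thesis using IH(2) i P by (auto simp: links_def)
    qed
    then show "even (length (P i 1))" "odd (length (P i 2))" by auto
  next
    fix m i assume m: "m < Suc n" and i: "i < m"
    show "anti (set (P i 1) \<union> set (P i 2) - {p (Suc i)}) (set (tl (P m 1)) \<union> set (tl (P m 2)))"
    proof (cases "m = n")
      case True
      have "set (P i 1) \<union> set (P i 2) - {p (Suc i)} \<subseteq> old_verts n q Q"
        using i True p P by (auto simp: old_verts_def)
      then show ?thesis using lk(10) True Pn anti_mono by (metis subset_refl)
    next
      case False
      then show ?thesis using IH(2) i m p P by (auto simp: links_def)
    qed
  qed
  moreover have "rope_state (p (Suc n)) R' F' (old_verts (Suc n) p P) (p ` {..Suc n})"
    using lk(11) p oldS im by simp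
  moreover have "\<not> near 5 (p i) (p m)" if "m \<le> Suc n" "i < m" for m i
    using that IH(5) far[OF _ lk(9), of i] p by (cases "m = Suc n") auto
  moreover have "p i \<in> C" if "0 < i" "i \<le> Suc n" for i
    using that IH(6) lk(9) FC p by (cases "i = Suc n") auto
  ultimately show ?case using IH(1) p lk(12) by (intro exI[of _ p] exI[of _ P] exI[of _ R'] exI[of _ F']) auto
qed

lemma conn_insert:
  assumes "conn S" "v \<in> S" "adj u v" shows "conn (insert u S)"
proof -
  have mono: "(step (insert u S))\<^sup>*\<^sup>* x y" if "(step S)\<^sup>*\<^sup>* x y" for x y
    using that by (rule rtranclp_mono[THEN predicate2D, rotated]) (auto simp: step_def)
  have uv: "step (insert u S) u v" using assms by (simp add: step_def)
  have from_u: "(step (insert u S))\<^sup>*\<^sup>* u y" if "y \<in> insert u S" for y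
  proof (cases "y = u")
    case False
    then have "(step (insert u S))\<^sup>*\<^sup>* v y" using assms that mono by (auto simp: conn_def)
    then show ?thesis using uv by (rule converse_rtranclp_into_rtranclp[rotated])
  qed simp
  show ?thesis unfolding conn_def
  proof (intro conjI ballI)
    fix x y assume "x \<in> insert u S" "y \<in> insert u S"
    then show "(step (insert u S))\<^sup>*\<^sup>* x y"
      using from_u step_rtranclp_sym by (metis rtranclp_trans)
  qed simp
qed

text \<open>The closing path leaves \<open>R\<close> at the first vertex that has a common neighbour in \<open>W\<close> with \<open>F\<close>.\<close>

lemma closing_path:
  assumes st: "rope_state q R F A Qs" and qC: "q \<in> C" and aA: "a \<in> A" and far_q: "\<not> near 1 a q"
  obtains Cl where "ipath Cl" "hd Cl = q" "last Cl = a" "anti (A - {a}) (set (tl Cl) - {a})"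
    "set Cl \<subseteq> A0 \<union> A1 \<union> W \<union> C" "length Cl \<ge> 4"
proof -
  have R: "ipath R" "hd R = q" "set (tl R) \<subseteq> C" "anti (set (butlast R)) F" "last R \<notin> F"
    and FC: "F \<subseteq> C" and AF: "anti A (set (tl R) \<union> F)" and AC: "A \<subseteq> C \<union> W"
    and far: "\<And>f. f \<in> F \<Longrightarrow> \<not> near 5 a f"
    and par: "\<And>f b. f \<in> F \<Longrightarrow> b \<in> W \<Longrightarrow> adj f b \<Longrightarrow> b \<notin> A \<and> (\<forall>v\<in>A. \<not> adj b v) \<and>
        (\<forall>p\<in>A1. adj b p \<longrightarrow> (\<forall>v\<in>A. \<not> adj p v))"
    and paA: "\<And>v. v \<in> A \<Longrightarrow> v \<in> W \<Longrightarrow> v = a \<or> \<not> adj pa v"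
    using st unfolding rope_state_def by auto
  obtain f where f: "f \<in> F" "adj (last R) f" using st unfolding rope_state_def by blast
  have Rne: "R \<noteq> []" using R(1) ipath_nonempty by blast
  have RC: "set R \<subseteq> C" using R(2,3) qC set_hd_tl[OF Rne] by simp
  have setR: "set R = insert (last R) (set (butlast R))" by (rule set_butlast_last[OF Rne])
  \<comment> \<open>Appending \<open>f\<close> makes the search below succeed, since
    \<open>f\<close> shares any of its parents with itself.\<close>
  define L where "L = R @ [f]"
  have L: "ipath L" unfolding L_def
    by (rule ipath_snoc[OF R(1) _ f(2)]) (use R(4,5) f(1) setR in \<open>auto simp: anti_def\<close>)
  have LC: "set L \<subseteq> C" using RC f FC by (auto simp: L_def)
  \<comment> \<open>A parent shared with a vertex of \<open>F\<close> inherits the separation from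
    \<open>A\<close>; taking the first such index excludes neighbours of \<open>b\<close> earlier on
    the path.\<close>
  define Pr where "Pr j \<longleftrightarrow> j < length L \<and> (\<exists>b\<in>W. \<exists>g\<in>F. adj b g \<and> adj (L ! j) b)" for j
  obtain b0 where "b0 \<in> W" "adj f b0" using C_W f FC by blast
  then have "Pr (length R)" using f adj_sym by (auto simp: Pr_def L_def)
  then have ex: "Pr (LEAST j. Pr j)" and least: "\<And>j. j < (LEAST j. Pr j) \<Longrightarrow> \<not> Pr j"
    by (auto intro: LeastI dest: not_less_Least)
  define j where "j = (LEAST j. Pr j)"
  obtain b g where b: "b \<in> W" "g \<in> F" "adj b g" "adj (L ! j) b" and jL: "j < length L"
    using ex unfolding j_def[symmetric] by (auto simp: Pr_def)
  have bnd: "b \<notin> A" "\<And>v. v \<in> A \<Longrightarrow> \<not> adj b v"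
    "\<And>p v. p \<in> A1 \<Longrightarrow> adj b p \<Longrightarrow> v \<in> A \<Longrightarrow> \<not> adj p v"
    using par[OF b(2,1)] b(3) adj_sym by blast+
  define T where "T = take (Suc j) L"
  have T_eq: "T = take j L @ [L ! j]" using jL by (simp add: T_def take_Suc_conv_app_nth)
  have hdL: "hd L = q" using R(2) Rne by (simp add: L_def)
  have T: "ipath T" "T \<noteq> []" "last T = L ! j" "hd T = q" "butlast T = take j L" "set T \<subseteq> C"
    using ipath_take[OF L, of "Suc j"] hd_take[of "Suc j" L] hdL LC set_take_subset[of "Suc j" L] T_eq
    by (simp_all add: T_def[symmetric]) blast
  have T_sub: "set T \<subseteq> insert q (set (tl R) \<union> F)"
  proof -
    have "set T \<subseteq> set R \<union> {f}" using set_take_subset[of "Suc j" L] by (auto simp: T_def L_def)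
    then show ?thesis using set_hd_tl[OF Rne] R(2) f(1) by auto
  qed
  have Tb: "ipath (T @ [b])"
  proof (rule ipath_snoc[OF T(1)])
    show "b \<notin> set T" using T(6) b(1) disj by blast
    show "adj (last T) b" using T(3) b(4) by simp
    fix z assume "z \<in> set (butlast T)"
    then obtain i where i: "i < j" "z = L ! i" using T(5) jL by (auto simp: in_set_conv_nth)
    have "\<not> Pr i" by (rule least) (use i(1) in \<open>simp only: j_def\<close>)
    then show "\<not> adj z b" using i jL b by (auto simp: Pr_def)
  qed
  have near_b: "near 4 a g" if "near 3 a b" using near_step[OF that b(3)] by simp
  have nb: "\<not> near 3 a b" using near_b far[OF b(2)] near_mono[of 4 a g 5] by auto
  have near2: "near 2 a v" if "adj a u" "adj u v" for u v
    using near_step[OF near_step[OF near_refl[of 0 a] that(1)] that(2)] by (simp add: numeral_2_eq_2)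
  have bpa: "\<not> adj b pa" using near2[OF a(3), of b] nb near_mono[of 2 a b 3] adj_sym by auto
  have ab: "\<not> adj a b" "a \<noteq> b"
    using near_step[OF near_refl[of 0 a], of b] near_mono[of "Suc 0" a b 3] near_refl[of 3 a] nb by auto
  obtain p where p: "p \<in> A1" "adj b p" using W_A1 b(1) by blast
  have ap: "\<not> adj a p" using near2[of p b] nb near_mono[of 2 a b 3] adj_sym[OF p(2)] by auto
  \<comment> \<open>The grandparents \<open>p\<close> and \<open>pa\<close> are connected through
    the top part \<open>A0\<close>, which touches neither \<open>W\<close> nor
    \<open>C\<close>.\<close>
  define D where "D = insert p (insert pa A0)"
  obtain u0 u1 where u: "u0 \<in> A0" "adj pa u0" "u1 \<in> A0" "adj p u1" using A1_A0 a(2) p(1) by blast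
  have D: "conn D" unfolding D_def
    using conn_insert[OF conn_insert[OF conn_A0 u(1,2)], of u1 p] u(3,4) by simp
  have sep: "x \<noteq> y" if "x \<in> A0 \<union> A1" "y \<in> W \<union> C" for x y
    using that anti_A0 anti_A1 disj unfolding anti_def by blast
  have DA: "D \<subseteq> A0 \<union> A1" using p(1) a(2) by (auto simp: D_def)
  obtain V where V: "ipath V" "hd V \<in> {b}" "set (tl V) \<subseteq> D" "\<exists>v\<in>{pa}. adj (last V) v"
    "anti (set (butlast V)) {pa}" "last V \<notin> {pa}"
  proof (rule short_path[OF D, of "{b}" b p "{pa}"])
    show "{b} \<inter> D = {}" using sep[of b b] DA b(1) by auto
    show "p \<in> D" "{pa} \<subseteq> D" by (auto simp: D_def)
  qed (use p bpa that in auto)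
  have Vne: "V \<noteq> []" using V(1) ipath_nonempty by blast
  have hdV: "hd V = b" using V(2) by simp
  have setV: "set V = insert (last V) (set (butlast V))" by (rule set_butlast_last[OF Vne])
  have setV2: "set V = insert b (set (tl V))" using set_hd_tl[OF Vne] hdV by simp
  have npa: "pa \<notin> set V" using V(5,6) setV by (auto simp: anti_def)
  have V1: "ipath (V @ [pa])"
    by (rule ipath_snoc[OF V(1) npa]) (use V(4,5) in \<open>auto simp: anti_def\<close>)
  have V2: "ipath (V @ [pa, a])"
  proof -
    have aV: "z \<noteq> a \<and> \<not> adj z a" if "z \<in> set V" for z
    proof -
      have "z = b \<or> z = p \<or> z \<in> A0" using that setV2 V(3) npa by (auto simp: D_def)
      moreover have "z \<noteq> a \<and> \<not> adj z a" if "z \<in> A0" using that anti_A0 a(1) unfolding anti_def by blast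
      moreover have "p \<noteq> a" using sep[of p a] p a by blast
      ultimately show ?thesis using ab ap adj_sym by blast
    qed
    have "ipath ((V @ [pa]) @ [a])"
      by (rule ipath_snoc[OF V1]) (use aV a adj_sym sep[of pa a] in auto)
    then show ?thesis by simp
  qed
  \<comment> \<open>The route: along \<open>R\<close> towards the region, up through
    \<open>b\<close>, within \<open>D\<close> to \<open>pa\<close>, and down to
    \<open>a\<close>.\<close>
  define Cl where "Cl = (T @ [b]) @ tl (V @ [pa, a])"
  have tlV: "tl (V @ [pa, a]) = tl V @ [pa, a]" using Vne by simp
  have aT: "z \<noteq> a \<and> \<not> adj z a" if "z \<in> set T" for z
  proof (cases "z = q")
    case True
    then show ?thesis using far_q near_refl[of 1 a] near_step[OF near_refl[of 0 a], of q] adj_sym by auto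
  next
    case False
    then show ?thesis using that T_sub AF aA adj_sym unfolding anti_def by blast
  qed
  have DT: "anti (set T) D"
  proof -
    have "anti (A0 \<union> A1) C" using anti_A0 anti_A1 unfolding anti_def by blast
    then show ?thesis using T(6) DA adj_sym unfolding anti_def by blast
  qed
  show thesis
  proof (rule that[of Cl])
    show "ipath Cl" unfolding Cl_def
    proof (rule ipath_append[OF Tb V2])
      show "last (T @ [b]) = hd (V @ [pa, a])" using hdV Vne by simp
      have "set (tl V @ [pa, a]) \<subseteq> D \<union> {a}" using V(3) by (auto simp: D_def)
      moreover have "anti (set T) (D \<union> {a})" using DT aT unfolding anti_def by blast
      ultimately show "anti (set (butlast (T @ [b]))) (set (tl (V @ [pa, a])))"
        unfolding tlV using anti_mono by fastforce
    qed
    show "hd Cl = q" "last Cl = a" "length Cl \<ge> 4" using T tlV by (auto simp: Cl_def Suc_le_eq)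
    show "set Cl \<subseteq> A0 \<union> A1 \<union> W \<union> C"
      using T(6) b(1) V(3) DA a(1,2) by (auto simp: Cl_def tlV)
    have "set (tl Cl) - {a} \<subseteq> set (tl R) \<union> F \<union> {b} \<union> A0 \<union> {p, pa}"
    proof -
      have "set (tl T) \<subseteq> set (tl R) \<union> F"
      proof -
        have "q \<notin> set (tl T)" using ipath_distinct[OF T(1)] T(2,4) by (cases T) auto
        moreover have "set (tl T) \<subseteq> set T" using T(2) by (cases T) auto
        ultimately show ?thesis using T_sub by blast
      qed
      moreover have "set (tl Cl) = set (tl T) \<union> {b} \<union> set (tl V) \<union> {pa, a}"
        using T(2) tlV by (auto simp: Cl_def)
      ultimately show ?thesis using V(3) by (auto simp: D_def)
    qed
    moreover have "anti (A - {a}) (set (tl R) \<union> F \<union> {b} \<union> A0 \<union> {p, pa})"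
      unfolding anti_def
    proof (intro ballI)
      fix v w assume v: "v \<in> A - {a}" and w: "w \<in> set (tl R) \<union> F \<union> {b} \<union> A0 \<union> {p, pa}"
      have vCW: "v \<in> W \<union> C" using v AC by blast
      consider "w \<in> set (tl R) \<union> F" | "w = b" | "w \<in> A0" | "w = p" | "w = pa" using w by blast
      then show "v \<noteq> w \<and> \<not> adj v w"
      proof cases
        case 1
        then show ?thesis using v AF unfolding anti_def by blast
      next
        case 2
        then show ?thesis using v bnd(1,2) adj_sym by blast
      next
        case 3
        then show ?thesis using vCW anti_A0 adj_sym unfolding anti_def by blast
      next
        case 4
        then show ?thesis using v bnd(3)[OF p] sep[of p v] vCW p(1) adj_sym by blast
      next
        case 5
        \<comment> \<open>The last clause of \<open>rope_state\<close> was carried along for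
          this.\<close>
        have "\<not> adj pa v"
        proof (cases "v \<in> W")
          case True
          then show ?thesis using paA v by blast
        next
          case False
          then show ?thesis using vCW anti_A1 a(2) unfolding anti_def by blast
        qed
        then show ?thesis using 5 sep[of pa v] vCW a(2) adj_sym by blast
      qed
    qed
    ultimately show "anti (A - {a}) (set (tl Cl) - {a})" using anti_mono by blast
  qed
qed

fun conc :: "(nat \<Rightarrow> nat \<Rightarrow> 'a list) \<Rightarrow> (nat \<Rightarrow> nat) \<Rightarrow> nat \<Rightarrow> 'a list" where
  "conc Q h 0 = [a]"
| "conc Q h (Suc n) = conc Q h n @ tl (Q n (h n))"

text \<open>Each new tail is separated from all earlier vertices except the common one, which is
  what \<open>ipath_append\<close> requires.\<close>

lemma conc_ipath:
  assumes lk: "links r q Q" and q0: "q 0 = a" and h: "\<And>i. i < r \<Longrightarrow> h i \<in> {1, 2}" and n: "n \<le> r"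
  shows "ipath (conc Q h n) \<and> hd (conc Q h n) = a \<and> last (conc Q h n) = q n \<and>
    set (butlast (conc Q h n)) \<subseteq> old_verts n q Q"
  using n
proof (induction n)
  case 0
  then show ?case using q0 by simp
next
  case (Suc n)
  then have IH: "ipath (conc Q h n)" "hd (conc Q h n) = a" "last (conc Q h n) = q n"
    "set (butlast (conc Q h n)) \<subseteq> old_verts n q Q" and n: "n < r" by auto
  define Z where "Z = Q n (h n)"
  have Z: "ipath Z" "hd Z = q n" "last Z = q (Suc n)" using lk n h unfolding links_def Z_def by blast+
  have Zs: "set Z \<subseteq> set (Q n 1) \<union> set (Q n 2)" "set (tl Z) \<subseteq> set (tl (Q n 1)) \<union> set (tl (Q n 2))"
    using h[OF n] by (auto simp: Z_def)
  have ne: "conc Q h n \<noteq> []" "Z \<noteq> []" using IH(1) Z(1) ipath_nonempty by blast+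
  have "anti (old_verts n q Q) (set (tl (Q n 1)) \<union> set (tl (Q n 2)))"
    using lk n unfolding links_def old_verts_def anti_def by blast
  then have "anti (set (butlast (conc Q h n))) (set (tl Z))" by (rule anti_mono[OF _ IH(4) Zs(2)])
  then have ip: "ipath (conc Q h n @ tl Z)" using ipath_append[OF IH(1) Z(1)] IH(3) Z(2) by simp
  have lst: "last (conc Q h n @ tl Z) = q (Suc n)"
    using IH(3) Z(2,3) ne by (cases Z) (auto simp: last_append)
  have "set (conc Q h n @ tl Z) - {q (Suc n)} \<subseteq> old_verts (Suc n) q Q"
  proof -
    have "set (conc Q h n) \<subseteq> insert (q n) (old_verts n q Q)"
      using set_butlast_last[OF ne(1)] IH(3,4) by auto
    moreover have "q n \<in> set Z" "set (tl Z) \<subseteq> set Z" using Z(2) ne(2) by (cases Z; auto)+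
    moreover have "set Z - {q (Suc n)} \<subseteq> old_verts (Suc n) q Q"
      using Zs(1) by (auto simp: old_verts_def lessThan_Suc)
    moreover have "old_verts n q Q \<subseteq> old_verts (Suc n) q Q" by (auto simp: old_verts_def lessThan_Suc)
    ultimately show ?thesis by auto
  qed
  moreover have "last p \<notin> set (butlast p)" if "ipath p" for p
    using ipath_distinct[OF that] by (cases p rule: rev_cases) auto
  from this[OF ip] have "set (butlast (conc Q h n @ tl Z)) \<subseteq> set (conc Q h n @ tl Z) - {q (Suc n)}"
    using lst in_set_butlastD by (metis Diff_empty subset_Diff_insert subsetI)
  ultimately show ?case using ip lst IH(2) ne(1) unfolding Z_def by auto
qed

end

section \<open>Choice of a level of large chromatic number\<close>

context girth15
begin

text \<open>If all levels were \<open>m\<close>-colourable, disjoint palettes for even and odd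
  levels would colour the component with \<open>2 * m\<close> colours. Edges never skip a level,
  which gives the separations between the layers.\<close>

lemma layering:
  assumes X: "finite X" "\<not> colr (2 * m) X" "m \<ge> 1"
  obtains A0 A1 W C a pa c where "layers adj A0 A1 W C a pa" "conn C" "\<not> colr m C" "c \<in> C" "adj a c"
    "A0 \<union> A1 \<union> W \<union> C \<subseteq> X"
proof -
  obtain K where K: "iscomp K X" "\<not> colr (2 * m) K" using big_comp[OF X(2)] by blast
  have KX: "K \<subseteq> X" "conn K" using K(1) by (auto simp: iscomp_def)
  obtain \<rho> where \<rho>: "\<rho> \<in> K" using KX(2) by (auto simp: conn_def)
  define l where "l = lev K \<rho>"
  have reach: "(step K)\<^sup>*\<^sup>* \<rho> v" if "v \<in> K" for v using KX(2) \<rho> that by (simp add: conn_def)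
  have l_adj: "l v \<le> Suc (l u)" if "u \<in> K" "v \<in> K" "adj u v" for u v
    using lev_adj[of K \<rho> u v] reach that by (simp add: l_def step_def)
  have l_pred: "\<exists>u\<in>K. adj v u \<and> l u = n" if v: "v \<in> K" "l v = Suc n" for v n
  proof -
    obtain u where "step K u v" "lev K \<rho> u = n" using lev_pred[OF reach[OF v(1)]] v(2) unfolding l_def by blast
    then show ?thesis using adj_sym by (auto simp: step_def l_def)
  qed
  have "\<exists>i. \<not> colr m {v \<in> K. l v = i}"
  proof (rule ccontr)
    assume "\<not> ?thesis"
    then have "\<forall>i. \<exists>c :: 'a \<Rightarrow> nat. (\<forall>v\<in>{v \<in> K. l v = i}. c v < m) \<and>
      (\<forall>u\<in>{v \<in> K. l v = i}. \<forall>v\<in>{v \<in> K. l v = i}. adj u v \<longrightarrow> c u \<noteq> c v)"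
      unfolding colr_def by blast
    from choice[OF this] obtain c :: "nat \<Rightarrow> 'a \<Rightarrow> nat" where
      c0: "\<And>i. (\<forall>v\<in>{v \<in> K. l v = i}. c i v < m) \<and>
      (\<forall>u\<in>{v \<in> K. l v = i}. \<forall>v\<in>{v \<in> K. l v = i}. adj u v \<longrightarrow> c i u \<noteq> c i v)" by blast
    have c: "\<And>v. v \<in> K \<Longrightarrow> c (l v) v < m"
        "\<And>u v. u \<in> K \<Longrightarrow> v \<in> K \<Longrightarrow> l u = l v \<Longrightarrow> adj u v \<Longrightarrow> c (l v) u \<noteq> c (l v) v" using c0 by auto
    define d where "d v = c (l v) v + (if even (l v) then 0 else m)" for v
    have "colr (2 * m) K" unfolding colr_def
    proof (intro exI[of _ d] conjI ballI impI)
      fix v assume "v \<in> K"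
      then show "d v < 2 * m" using c(1)[of v] by (simp add: d_def)
    next
      fix u v assume uv: "u \<in> K" "v \<in> K" "adj u v"
      show "d u \<noteq> d v"
      proof (cases "l u = l v")
        case True
        then show ?thesis using c(2)[of u v] uv by (simp add: d_def)
      next
        case False
        have "l u \<le> Suc (l v)" "l v \<le> Suc (l u)" using l_adj[of u v] l_adj[of v u] uv adj_sym by simp_all
        then have "even (l u) \<noteq> even (l v)" using False by (metis Suc_leI even_Suc le_antisym not_less)
        then show ?thesis using c(1)[OF uv(1)] c(1)[OF uv(2)] by (auto simp: d_def)
      qed
    qed
    then show False using K(2) by blast
  qed
  then obtain i where i: "\<not> colr m {v \<in> K. l v = i}" by blast
  \<comment> \<open>Levels up to 6 are stable, so the chosen level leaves room for \<open>W\<close>,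
    \<open>A1\<close> and \<open>A0\<close> above it.\<close>
  have "i > 6"
  proof (rule ccontr)
    assume "\<not> i > 6"
    then have "\<not> adj u v" if "u \<in> {v \<in> K. l v = i}" "v \<in> {v \<in> K. l v = i}" for u v
      using level_stable[of K \<rho> u v] reach that by (auto simp: l_def)
    then show False using i colr_stable X(3) by blast
  qed
  define n where "n = i - 3"
  have n: "i = Suc (Suc (Suc n))" using \<open>i > 6\<close> by (simp add: n_def)
  obtain C where C: "iscomp C {v \<in> K. l v = i}" "\<not> colr m C" using big_comp[OF i] by blast
  define W where "W = {v \<in> K. l v = Suc (Suc n)}"
  define A1 where "A1 = {v \<in> K. l v = Suc n}"
  define A0 where "A0 = {v \<in> K. l v \<le> n}"
  have CK: "C \<subseteq> {v \<in> K. l v = i}" "conn C" using C(1) by (auto simp: iscomp_def)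
  have gap: "\<not> adj u v" if "u \<in> K" "v \<in> K" "Suc (l u) < l v" for u v using l_adj[of u v] that by auto
  obtain c where c: "c \<in> C" using CK(2) by (auto simp: conn_def)
  have CW: "\<exists>b\<in>W. adj c b" if "c \<in> C" for c
    using l_pred[of c "Suc (Suc n)"] that CK(1) n by (auto simp: W_def)
  have WA: "\<exists>p\<in>A1. adj b p" if "b \<in> W" for b using l_pred[of b "Suc n"] that by (auto simp: W_def A1_def)
  have AA: "\<exists>u\<in>A0. adj p u" if "p \<in> A1" for p using l_pred[of p n] that by (auto simp: A1_def A0_def)
  obtain a where a: "a \<in> W" "adj c a" using CW[OF c] by blast
  obtain pa where pa: "pa \<in> A1" "adj a pa" using WA[OF a(1)] by blast
  have "conn A0"
  proof -
    have \<rho>A: "\<rho> \<in> A0" using \<rho> by (simp add: A0_def l_def)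
    have r: "(step A0)\<^sup>*\<^sup>* \<rho> v" if "v \<in> A0" for v
      using that
    proof (induction "l v" arbitrary: v)
      case 0
      then have "v = \<rho>" using lev_0[of K \<rho> v] reach by (simp add: l_def A0_def)
      then show ?case by simp
    next
      case (Suc k)
      then obtain u where u: "u \<in> K" "adj v u" "l u = k" using l_pred[of v k] by (auto simp: A0_def)
      then have "u \<in> A0" using Suc(2,3) by (auto simp: A0_def)
      then have "(step A0)\<^sup>*\<^sup>* \<rho> u" "step A0 u v" using Suc(1)[of u] Suc(3) u adj_sym by (auto simp: step_def)
      then show ?case by (rule rtranclp.rtrancl_into_rtrancl)
    qed
    show ?thesis unfolding conn_def
    proof (intro conjI ballI)
      fix u v assume "u \<in> A0" "v \<in> A0"
      then show "(step A0)\<^sup>*\<^sup>* u v" using r step_rtranclp_sym by (metis rtranclp_trans)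
    qed (use \<rho>A in auto)
  qed
  moreover have "anti A0 (W \<union> C)" unfolding anti_def
  proof (intro ballI)
    fix u v assume "u \<in> A0" "v \<in> W \<union> C"
    then have "u \<in> K" "v \<in> K" "Suc (l u) < l v" using CK(1) n by (auto simp: A0_def W_def)
    then show "u \<noteq> v \<and> \<not> adj u v" using gap by auto
  qed
  moreover have "anti A1 C" unfolding anti_def
  proof (intro ballI)
    fix u v assume "u \<in> A1" "v \<in> C"
    then have "u \<in> K" "v \<in> K" "Suc (l u) < l v" using CK(1) n by (auto simp: A1_def)
    then show "u \<noteq> v \<and> \<not> adj u v" using gap by auto
  qed
  moreover have "W \<inter> C = {}" "A1 \<inter> W = {}" using CK(1) n by (auto simp: W_def A1_def)
  moreover have "C \<subseteq> X" using CK(1) KX(1) by blast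
  then have "finite C" using X(1) by (rule finite_subset)
  ultimately have "layers adj A0 A1 W C a pa"
    using CW WA AA a pa by unfold_locales auto
  moreover have "A0 \<union> A1 \<union> W \<union> C \<subseteq> X" using CK(1) KX(1) by (auto simp: A0_def A1_def W_def)
  ultimately show thesis using that CK(2) C(2) c a adj_sym by blast
qed

end

section \<open>The rope as a subgraph\<close>

lemma edges_walk_graph_simps [simp]:
  "edges (walk_graph []) = {}" "edges (walk_graph [x]) = {}"
  "edges (walk_graph (x # y # xs)) = insert {x, y} (edges (walk_graph (y # xs)))"
proof -
  show "edges (walk_graph (x # y # xs)) = insert {x, y} (edges (walk_graph (y # xs)))" (is "?L = ?R")
  proof (rule set_eqI)
    fix e
    have "e \<in> ?L \<longleftrightarrow> (\<exists>i. Suc i < length (x # y # xs) \<and> e = {(x # y # xs) ! i, (y # xs) ! i})"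
      by (auto simp: walk_graph_def)
    also have "\<dots> \<longleftrightarrow> e = {x, y} \<or> (\<exists>i. Suc i < length (y # xs) \<and> e = {(y # xs) ! i, (y # xs) ! Suc i})"
      (is "?A \<longleftrightarrow> ?B")
    proof
      assume ?A
      then obtain i where "Suc i < length (x # y # xs)" "e = {(x # y # xs) ! i, (y # xs) ! i}" by blast
      then show ?B by (cases i) auto
    next
      assume ?B
      then show ?A
      proof
        assume "e = {x, y}"
        then show ?A by (intro exI[of _ 0]) simp
      next
        assume "\<exists>i. Suc i < length (y # xs) \<and> e = {(y # xs) ! i, (y # xs) ! Suc i}"
        then obtain i where "Suc i < length (y # xs)" "e = {(y # xs) ! i, (y # xs) ! Suc i}" by blast
        then show ?A by (intro exI[of _ "Suc i"]) simp
      qed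
    qed
    also have "\<dots> \<longleftrightarrow> e \<in> ?R" by (auto simp: walk_graph_def)
    finally show "e \<in> ?L \<longleftrightarrow> e \<in> ?R" .
  qed
qed (simp_all add: walk_graph_def)

lemma verts_walk_graph [simp]: "verts (walk_graph p) = set p"
  by (simp add: walk_graph_def)

lemma edges_walk_graph_subset: "e \<in> edges (walk_graph p) \<Longrightarrow> e \<subseteq> set p"
  by (auto simp: walk_graph_def)

lemma edges_walk_graph_append:
  assumes "p \<noteq> []" "q \<noteq> []" "last p = hd q"
  shows "edges (walk_graph (p @ tl q)) = edges (walk_graph p) \<union> edges (walk_graph q)"
  using assms
proof (induction p)
  case (Cons x p)
  show ?case
  proof (cases p)
    case Nil
    then show ?thesis using Cons by (cases q) auto
  next
    case (Cons y p')
    then show ?thesis using Cons.IH Cons.prems by simp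
  qed
qed simp

section \<open>Closed odd walks and odd girth\<close>

lemma walk_iff_successively:
  "walk G p \<longleftrightarrow> p \<noteq> [] \<and> set p \<subseteq> verts G \<and> successively (\<lambda>u v. {u, v} \<in> edges G) p"
  by (auto simp: walk_def successively_conv_nth)

lemma successively_relpowp:
  "successively R p \<Longrightarrow> p \<noteq> [] \<Longrightarrow> (R ^^ (length p - 1)) (hd p) (last p)"
proof (induction p)
  case (Cons x p)
  show ?case
  proof (cases "p = []")
    case False
    then have "R x (hd p)" "(R ^^ (length p - 1)) (hd p) (last p)"
      using Cons by (auto simp: successively_Cons)
    then have "(R ^^ Suc (length p - 1)) x (last p)" by (rule relpowp_Suc_I2)
    then show ?thesis using False by (simp del: relpowp.simps)
  qed simp
qed simp

text \<open>A repeated vertex splits a closed walk into two shorter closed walks whose lengths add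
  up, so one of them is odd. Without repetition the walk is a cycle, as length 1 would need a
  loop.\<close>

lemma odd_closed_walk:
  assumes "simple_graph G" "walk G p" "hd p = last p" "odd (walk_length p)"
  shows "\<exists>c. cycle G c \<and> odd (walk_length c) \<and> walk_length c \<le> walk_length p"
  using assms(2-4)
proof (induction p rule: length_induct)
  case (1 p)
  note IH = 1(1)
  have irr: "{x, x} \<notin> edges G" for x using assms(1) by (auto simp: simple_graph_def)
  obtain x xs where p: "p = x # xs" using 1(2) by (cases p) (auto simp: walk_def)
  have xs: "xs \<noteq> []" using 1(4) p by (auto simp: walk_length_def)
  show ?case
  proof (cases "distinct xs")
    case True
    have "walk_length p \<noteq> 1"
    proof
      assume "walk_length p = 1"
      then have "p = [x, x]" using 1(3) p by (cases xs) (auto simp: walk_length_def)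
      then show False using 1(2) irr by (simp add: walk_iff_successively)
    qed
    then have "walk_length p \<ge> 3" using 1(4) by (cases "walk_length p = 2") (auto elim!: oddE)
    then show ?thesis using 1(2-4) True p by (intro exI[of _ p]) (simp add: cycle_def)
  next
    case False
    then obtain us v vs ws where d: "xs = us @ [v] @ vs @ [v] @ ws" using not_distinct_decomp by blast
    define p1 where "p1 = v # vs @ [v]"
    define p2 where "p2 = x # us @ v # ws"
    have V: "set p \<subseteq> verts G" and "successively (\<lambda>u v. {u, v} \<in> edges G) p"
      using 1(2) by (auto simp: walk_iff_successively)
    then have "successively (\<lambda>u v. {u, v} \<in> edges G) ((x # us) @ p1 @ ws)"
      and "successively (\<lambda>u v. {u, v} \<in> edges G) ((x # us @ v # vs) @ v # ws)"
      and "successively (\<lambda>u v. {u, v} \<in> edges G) ((x # us) @ v # vs @ v # ws)"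
      using p d by (simp_all add: p1_def)
    then have "successively (\<lambda>u v. {u, v} \<in> edges G) p1"
      and "successively (\<lambda>u v. {u, v} \<in> edges G) ((x # us) @ v # ws)"
      by (simp_all only: successively_append_iff list.sel list.distinct simp_thms)
    then have w: "walk G p1" "walk G p2"
      using V p d unfolding walk_iff_successively p1_def p2_def by auto
    have h: "hd p1 = last p1" "hd p2 = last p2" using 1(3) p d by (auto simp: p1_def p2_def)
    have len: "walk_length p = walk_length p1 + walk_length p2" "length p1 < length p" "length p2 < length p"
      using p d by (auto simp: p1_def p2_def walk_length_def)
    then consider "odd (walk_length p1)" | "odd (walk_length p2)" using 1(4) by auto
    then show ?thesis
    proof cases
      case 1
      then obtain c where "cycle G c" "odd (walk_length c)" "walk_length c \<le> walk_length p1"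
        using IH len(2) w(1) h(1) by blast
      then show ?thesis using len(1) by (intro exI[of _ c]) simp
    next
      case 2
      then obtain c where "cycle G c" "odd (walk_length c)" "walk_length c \<le> walk_length p2"
        using IH len(3) w(2) h(2) by blast
      then show ?thesis using len(1) by (intro exI[of _ c]) simp
    qed
  qed
qed

lemma graph_girth15:
  assumes G: "simple_graph G" "odd_girth G \<ge> 15"
  shows "girth15 (\<lambda>u v. {u, v} \<in> edges G)"
proof
  show "{v, u} \<in> edges G" if "{u, v} \<in> edges G" for u v using that by (simp add: insert_commute)
  show "{u, u} \<notin> edges G" for u using G(1) by (auto simp: simple_graph_def)
  fix n :: nat and u assume n: "odd n" "n < 15"
  show "\<not> ((\<lambda>u v. {u, v} \<in> edges G) ^^ n) u u"
  proof
    assume "((\<lambda>u v. {u, v} \<in> edges G) ^^ n) u u"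
    then obtain f where f: "f 0 = u" "f n = u" "\<And>i. i < n \<Longrightarrow> {f i, f (Suc i)} \<in> edges G"
      unfolding relpowp_fun_conv by blast
    define p where "p = map f [0..<Suc n]"
    have fV: "f i \<in> verts G" if "i \<le> n" for i
    proof (cases "i < n")
      case True
      then show ?thesis using f(3)[of i] G(1) by (auto simp: simple_graph_def)
    next
      case False
      then have "i = Suc (n - 1)" "n - 1 < n" using that n(1) by (auto elim: oddE)
      then show ?thesis using f(3)[of "n - 1"] G(1) by (auto simp: simple_graph_def)
    qed
    have nth: "p ! i = f i" if "i < Suc n" for i using that by (simp add: p_def del: upt_Suc)
    have "length p = Suc n" by (simp add: p_def)
    then have "walk G p" unfolding walk_def using fV f(3) nth
      by (auto simp: in_set_conv_nth)
    moreover have "hd p = last p"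
      using f(1,2) by (simp add: p_def hd_map last_map del: upt_Suc)
    moreover have wl: "walk_length p = n" by (simp add: p_def walk_length_def)
    ultimately obtain c where c: "cycle G c" "odd (walk_length c)" "walk_length c \<le> n"
      using odd_closed_walk[OF G(1), of p] n(1) by auto
    have "odd_girth G \<le> enat (walk_length c)"
      unfolding odd_girth_def by (rule INF_lower) (use c in auto)
    also have "\<dots> \<le> enat n" using c(3) by simp
    also have "\<dots> < 15" using n(2) by (simp add: numeral_eq_enat)
    finally show False using G(2) by simp
  qed
qed

section \<open>Closing up the rope in the graph\<close>

locale graph15 =
  fixes G :: "'a ugraph"
  assumes simple: "simple_graph G" and girth: "odd_girth G \<ge> 15"
begin

abbreviation adj :: "'a \<Rightarrow> 'a \<Rightarrow> bool" where
  "adj u v \<equiv> {u, v} \<in> edges G"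

sublocale girth15 adj
  by (rule graph_girth15[OF simple girth])

lemma ipath_successively: "ipath p \<Longrightarrow> successively adj p"
  by (induction p rule: ipath.induct) auto

lemma ipath_path_between:
  "ipath p \<Longrightarrow> set p \<subseteq> verts G \<Longrightarrow> path_between G (hd p) (last p) p"
  using ipath_successively ipath_distinct ipath_nonempty
  by (auto simp: path_between_def path_def walk_iff_successively)

lemma ipath_edges: "ipath p \<Longrightarrow> edges (walk_graph p) \<subseteq> edges G"
  by (induction p rule: ipath.induct) auto

lemma ipath_induced:
  "ipath p \<Longrightarrow> u \<in> set p \<Longrightarrow> v \<in> set p \<Longrightarrow> adj u v \<Longrightarrow> {u, v} \<in> edges (walk_graph p)"
proof (induction p rule: ipath.induct)
  case (2 x)
  then show ?case using adj_irrefl by auto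
next
  case (3 x y xs)
  consider "u = x" | "v = x" "u \<noteq> x" | "u \<in> set (y # xs)" "v \<in> set (y # xs)" using 3(3,4) by auto
  then show ?case
  proof cases
    case 1
    then have "v = y" using 3(2,4,5) adj_irrefl by auto
    then show ?thesis using 1 by simp
  next
    case 2
    then have "u = y" using 3(2,3,5) adj_commute by auto
    then show ?thesis using 2 by (simp add: insert_commute)
  next
    case 3
    then show ?thesis using "3.IH" "3.prems" by simp
  qed
qed simp

lemma not_near_graph_dist: "\<not> near 5 u v \<Longrightarrow> graph_dist G u v \<ge> 6"
  unfolding graph_dist_def
proof (rule INF_greatest)
  fix p assume n: "\<not> near 5 u v" and "p \<in> {p. path_between G u v p}"
  then have p: "successively adj p" "p \<noteq> []" "hd p = u" "last p = v"
    by (auto simp: path_between_def path_def walk_iff_successively)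
  have "(adj ^^ walk_length p) u v" using successively_relpowp[OF p(1,2)] p(3,4) by (simp add: walk_length_def)
  then have "\<not> walk_length p \<le> 5" using n unfolding near_def by blast
  then have "enat 6 \<le> enat (walk_length p)" by simp
  then show "6 \<le> enat (walk_length p)" by (simp only: numeral_eq_enat)
qed

text \<open>Both paths contain \<open>a\<close> and \<open>q\<close>, and no edge joins their
  interiors. So every edge of \<open>G\<close> on these vertices has both ends on one of the paths,
  where inducedness applies. The bound on \<open>Cl\<close> makes the cycle long enough.\<close>

lemma closed_rope:
  assumes P: "ipath P" "hd P = a" "last P = q" and Cl: "ipath Cl" "hd Cl = q" "last Cl = a"
    and aq: "a \<noteq> q" and an: "anti (set P - {a, q}) (set Cl - {a, q})"
    and V: "set P \<union> set Cl \<subseteq> verts G" and len: "length Cl \<ge> 4"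
  shows "cycle G (P @ tl Cl) \<and> induced_cycle G (walk_graph (P @ tl Cl))"
proof -
  have ne: "P \<noteq> []" "Cl \<noteq> []" using P(1) Cl(1) ipath_nonempty by blast+
  have d: "distinct P" "distinct Cl" using P(1) Cl(1) ipath_distinct by blast+
  have Pa: "P = a # tl P" and Cq: "Cl = q # tl Cl" using ne P(2) Cl(2) by (metis list.collapse)+
  have tlC: "tl Cl \<noteq> []" using Cl(2,3) aq ne(2) by (cases Cl) (auto split: if_splits)
  then have lst: "last (tl Cl) = a" using Cl(3) by (simp add: last_tl)
  have "q \<in> set P" using P(3) ne(1) last_in_set by blast
  moreover have "set Cl = insert q (set (tl Cl))" using set_hd_tl[OF ne(2)] Cl(2) by simp
  ultimately have setC: "set (P @ tl Cl) = set P \<union> set Cl" by auto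
  have E: "edges (walk_graph (P @ tl Cl)) = edges (walk_graph P) \<union> edges (walk_graph Cl)"
    by (rule edges_walk_graph_append) (use ne P Cl in auto)
  have "walk G (P @ tl Cl)"
  proof -
    have "successively adj (q # tl Cl)" using ipath_successively[OF Cl(1)] Cq by simp
    then have "successively adj (P @ tl Cl)"
      using ipath_successively[OF P(1)] P(3) ne tlC by (auto simp: successively_append_iff successively_Cons)
    then show ?thesis using ne V setC unfolding walk_iff_successively by auto
  qed
  moreover have "distinct (tl (P @ tl Cl))"
  proof -
    have "a \<notin> set (tl P)" "q \<notin> set (tl Cl)" using d Pa Cq by (metis distinct.simps(2))+
    moreover have "set (tl P) \<subseteq> set P" "set (tl Cl) \<subseteq> set Cl" using Pa Cq by (metis set_subset_Cons)+
    ultimately have "set (tl P) \<inter> set (tl Cl) = {}" using an unfolding anti_def by blast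
    then show ?thesis using ne d by (simp add: distinct_tl)
  qed
  ultimately have cyc: "cycle G (P @ tl Cl)"
    using ne tlC lst P(2) len by (cases P) (auto simp: cycle_def walk_length_def)
  have "{u, v} \<in> edges (walk_graph (P @ tl Cl))" if uv: "u \<in> set P \<union> set Cl" "v \<in> set P \<union> set Cl" "adj u v" for u v
  proof -
    have qa: "q \<in> set P" "a \<in> set Cl" "a \<in> set P" "q \<in> set Cl"
      using P Cl ne by (metis last_in_set hd_in_set)+
    consider "u \<in> set P" "v \<in> set P" | "u \<in> set Cl" "v \<in> set Cl"
      | "u \<in> set P - {a, q}" "v \<in> set Cl - {a, q}" | "v \<in> set P - {a, q}" "u \<in> set Cl - {a, q}"
      using uv(1,2) qa by blast
    then show ?thesis
    proof cases
      case 3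
      then show ?thesis using an uv(3) unfolding anti_def by blast
    next
      case 4
      then show ?thesis using an uv(3) adj_sym unfolding anti_def by blast
    qed (use ipath_induced P(1) Cl(1) uv(3) E in auto)
  qed
  moreover have "\<exists>u v. e = {u, v}" if "e \<in> edges G" for e
  proof -
    have "card e = 2" using simple that by (simp add: simple_graph_def)
    then show ?thesis by (metis card_2_iff)
  qed
  ultimately have sub: "e \<in> edges (walk_graph (P @ tl Cl))" if "e \<in> edges G" "e \<subseteq> set P \<union> set Cl" for e
    using that by (metis insert_subset)
  have "e \<in> edges G \<and> e \<subseteq> set P \<union> set Cl" if "e \<in> edges (walk_graph (P @ tl Cl))" for e
  proof
    show "e \<in> edges G" using that E ipath_edges P(1) Cl(1) by blast
    have "e \<subseteq> set (P @ tl Cl)" by (rule edges_walk_graph_subset[OF that])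
    then show "e \<subseteq> set P \<union> set Cl" using setC by simp
  qed
  then have "edges (walk_graph (P @ tl Cl)) = {e \<in> edges G. e \<subseteq> set P \<union> set Cl}" using sub by blast
  then have "walk_graph (P @ tl Cl) = induced G (verts (walk_graph (P @ tl Cl)))"
    unfolding induced_def using setC V by (intro ugraph.expand) auto
  then show ?thesis using cyc unfolding induced_cycle_def by blast
qed

lemma rope_exists:
  assumes X: "X \<subseteq> verts G" "\<not> colr (16 * r + 4) X" and r: "r \<ge> 1"
  shows "has_quasi_arithmetic_rope_in G r X"
proof -
  have finX: "finite X" using X(1) simple finite_subset by (auto simp: simple_graph_def)
  have "2 * (8 * r + 2) = 16 * r + 4" by simp
  then have X2: "\<not> colr (2 * (8 * r + 2)) X" using X(2) by metis
  have m: "8 * r + 2 \<ge> 1" by simp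
  obtain A0 A1 W C a pa c where lay: "layers adj A0 A1 W C a pa" and C: "conn C" "\<not> colr (8 * r + 2) C"
    "c \<in> C" "adj a c" and sub: "A0 \<union> A1 \<union> W \<union> C \<subseteq> X"
    by (rule layering[OF finX X2 m])
  interpret L: layers adj A0 A1 W C a pa by (rule lay)
  obtain R0 F0 where st0: "L.rope_state a R0 F0 {} {a}" "\<not> colr (8 * r) F0"
    using L.rope_start[OF C] by blast
  have "\<not> colr (8 * r + 0) F0" using st0(2) by simp
  from L.rope_chain[OF st0(1) this] obtain q Q R F where q0: "q 0 = a" and lk: "L.links r q Q"
    and st: "L.rope_state (q r) R F (L.old_verts r q Q) (q ` {..r})" 
    and farq: "\<forall>m\<le>r. \<forall>i<m. \<not> near 5 (q i) (q m)" and qC: "\<forall>i. 0 < i \<and> i \<le> r \<longrightarrow> q i \<in> C"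
    by (elim exE conjE) (rule that)
  define A where "A = L.old_verts r q Q"
  have AC: "A \<subseteq> C \<union> W" using st unfolding L.rope_state_def A_def by blast
  have Qp: "ipath (Q i j)" "hd (Q i j) = q i" "last (Q i j) = q (Suc i)" "Q i j \<noteq> []"
    if "i < r" "j \<in> {1, 2}" for i j
    using lk that ipath_nonempty unfolding L.links_def by blast+
  have qne: "q i \<noteq> q m" if "i < m" "m \<le> r" for i m using farq that near_refl[of 5 "q i"] by metis
  have QA: "set (Q i j) \<subseteq> insert (q (Suc i)) A" if "i < r" "j \<in> {1, 2}" for i j
    using that unfolding A_def L.old_verts_def by auto
  have QX: "set (Q i j) \<subseteq> X" if "i < r" "j \<in> {1, 2}" for i j
  proof -
    have "q (Suc i) \<in> C" using qC that(1) by simp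
    then show ?thesis using QA[OF that] AC sub by blast
  qed
  have a0: "a \<in> set (Q 0 1) \<union> set (Q 0 2) - {q (Suc 0)}"
    using Qp[of 0 1] r qne[of 0 1] q0 hd_in_set[of "Q 0 1"] by auto
  have aA: "a \<in> A" using a0 r unfolding A_def L.old_verts_def by (auto intro!: bexI[of _ 0])
  have far1: "\<not> near 1 a (q r)" using farq r q0 near_mono[of 1 a "q r" 5] by force
  obtain Cl where Cl: "ipath Cl" "hd Cl = q r" "last Cl = a" "anti (A - {a}) (set (tl Cl) - {a})"
    "set Cl \<subseteq> A0 \<union> A1 \<union> W \<union> C" "length Cl \<ge> 4"
    using L.closing_path[OF st _ _ far1] qC r aA unfolding A_def by auto
  have Clne: "Cl \<noteq> []" using Cl(6) by auto
  have ClX: "set Cl \<subseteq> X" using Cl(5) sub by blast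
  have qCl: "q r \<notin> set (tl Cl)" using ipath_distinct[OF Cl(1)] Cl(2) Clne by (cases Cl) auto
  have tlCl: "set (tl Cl) \<subseteq> set Cl" by (cases Cl) auto
  \<comment> \<open>If the list \<open>Cl\<close> is even, the closing path has odd length and flips
    the parity of the last link, so the two versions of that link are exchanged.\<close>
  define s where "s j = (if even (length Cl) then 3 - j else j)" for j :: nat
  have s: "s j \<in> {1, 2}" if "j \<in> {1, 2}" for j using that by (auto simp: s_def)
  define Q' where "Q' i j = (if Suc i = r then Q i (s j) @ tl Cl else Q i j)" for i j
  obtain r' where r': "r = Suc r'" using r by (cases r) auto
  \<comment> \<open>The cycle for a choice \<open>h\<close> is the concatenation for the adjusted
    choice \<open>h'\<close>, closed by \<open>Cl\<close>.\<close>
  have cyc: "cycle G (L.conc Q h' r @ tl Cl) \<and>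
      induced_cycle G (graph_Union {..<r} (\<lambda>i. walk_graph (Q' i (h i))))"
    if h: "\<And>i. i < r \<Longrightarrow> h i \<in> {1, 2}" and h'_def: "h' = (\<lambda>i. if Suc i = r then s (h i) else h i)" for h h'
  proof -
    have h': "\<And>i. i < r \<Longrightarrow> h' i \<in> {1, 2}" using h s by (auto simp: h'_def)
    have co: "ipath (L.conc Q h' n)" "hd (L.conc Q h' n) = a" "last (L.conc Q h' n) = q n"
      "set (butlast (L.conc Q h' n)) \<subseteq> L.old_verts n q Q" if "n \<le> r" for n
      using L.conc_ipath[OF lk q0 h' that] by auto
    have setco: "set (L.conc Q h' n) = insert a (\<Union>i<n. set (Q i (h' i))) \<and>
        edges (walk_graph (L.conc Q h' n)) = (\<Union>i<n. edges (walk_graph (Q i (h' i))))" if "n \<le> r" for n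
      using that
    proof (induction n)
      case (Suc n)
      have Qn: "Q n (h' n) \<noteq> []" "hd (Q n (h' n)) = q n" using Qp[OF _ h'] Suc.prems by auto
      have cn: "L.conc Q h' n \<noteq> []" "last (L.conc Q h' n) = q n"
        using co Suc.prems ipath_nonempty by auto
      have "q n \<in> set (L.conc Q h' n)" using cn last_in_set by metis
      then have "set (L.conc Q h' n) \<union> set (tl (Q n (h' n))) = set (L.conc Q h' n) \<union> set (Q n (h' n))"
        using Qn by (cases "Q n (h' n)") auto
      then show ?case
        using Suc edges_walk_graph_append[OF cn(1) Qn(1)] cn(2) Qn(2) by (auto simp: lessThan_Suc)
    qed simp
    have ne: "L.conc Q h' r \<noteq> []" using co(1) ipath_nonempty by blast
    have setr: "set (L.conc Q h' r) \<subseteq> insert (q r) A"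
      using set_butlast_last[OF ne] co(3,4)[of r] unfolding A_def by auto
    have cl: "cycle G (L.conc Q h' r @ tl Cl) \<and> induced_cycle G (walk_graph (L.conc Q h' r @ tl Cl))"
    proof (rule closed_rope[OF co(1-3) Cl(1-3)])
      show "a \<noteq> q r" using qne[of 0 r] r q0 by auto
      have tc: "set Cl - {a, q r} \<subseteq> set (tl Cl) - {a}" using Clne Cl(2) by (cases Cl) auto
      have sc: "set (L.conc Q h' r) - {a, q r} \<subseteq> A - {a}" using setr by blast
      show "anti (set (L.conc Q h' r) - {a, q r}) (set Cl - {a, q r})"
        by (rule anti_mono[OF Cl(4) sc tc])
      have "q r \<in> C" using qC r by simp
      then have "q r \<in> X" using sub by blast
      then show "set (L.conc Q h' r) \<union> set Cl \<subseteq> verts G" using setr AC sub ClX X(1) by blast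
    qed (use Cl(6) in simp_all)
    have "walk_graph (L.conc Q h' r @ tl Cl) = graph_Union {..<r} (\<lambda>i. walk_graph (Q' i (h i)))"
    proof (rule ugraph.expand, intro conjI)
      have lr: "{..<r} = insert r' {..<r'}" using r' by auto
      have 1: "Q' i (h i) = Q i (h' i)" if "i < r'" for i using that r' by (simp add: Q'_def h'_def)
      have 2: "Q' r' (h r') = Q r' (h' r') @ tl Cl" using r' by (simp add: Q'_def h'_def)
      have Qr: "Q r' (h' r') \<noteq> []" "last (Q r' (h' r')) = q r" using Qp[OF _ h', of r'] r' by auto
      have e2: "edges (walk_graph (Q' r' (h r'))) = edges (walk_graph (Q r' (h' r'))) \<union> edges (walk_graph Cl)"
        unfolding 2 by (rule edges_walk_graph_append) (use Qr Clne Cl(2) in auto)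
      have e3: "edges (walk_graph (L.conc Q h' r @ tl Cl)) = edges (walk_graph (L.conc Q h' r)) \<union> edges (walk_graph Cl)"
        by (rule edges_walk_graph_append) (use ne Clne Cl(2) co(3) in auto)
      have "a \<in> (\<Union>i<r. set (Q i (h' i)))"
        using Qp[OF _ h', of 0] r q0 hd_in_set[of "Q 0 (h' 0)"] by (auto intro!: bexI[of _ 0])
      then show "verts (walk_graph (L.conc Q h' r @ tl Cl)) = verts (graph_Union {..<r} (\<lambda>i. walk_graph (Q' i (h i))))"
        using setco[of r] 1 2 unfolding lr by (auto simp: graph_Union_def)
      show "edges (walk_graph (L.conc Q h' r @ tl Cl)) = edges (graph_Union {..<r} (\<lambda>i. walk_graph (Q' i (h i))))"
        using setco[of r] e2 e3 1 unfolding lr by (auto simp: graph_Union_def)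
    qed
    then show ?thesis using cl by simp
  qed
  have lenQ: "even (length (Q i 1))" "odd (length (Q i 2))" if "i < r" for i
    using lk that unfolding L.links_def by blast+
  have par: "odd (walk_length (Q' i 1)) \<and> even (walk_length (Q' i 2))" if i: "i < r" for i
  proof -
    have l: "length (Q i 1) \<ge> 1" "length (Q i 2) \<ge> 1"
      using Qp(4)[OF i] by (auto simp: Suc_le_eq)
    show ?thesis
    proof (cases "Suc i = r")
      case True
      have "walk_length (Q i j @ tl Cl) = (length (Q i j) - 1) + (length Cl - 1)" if "j \<in> {1, 2}" for j
        using that l Cl(6) by (auto simp: walk_length_def)
      then show ?thesis using True lenQ[OF i] l Cl(6) by (auto simp: Q'_def s_def even_diff_nat)
    next
      case False
      then show ?thesis using lenQ[OF i] l by (auto simp: Q'_def walk_length_def even_diff_nat)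
    qed
  qed
  have path: "if r = 1 then cycle G (Q' i j) \<and> hd (Q' i j) = q i
        else path_between G (q i) (q (Suc i mod r)) (Q' i j)" if i: "i < r" and j: "j \<in> {1, 2}" for i j
  proof (cases "r = 1")
    case True
    have i0: "i = 0" using True i by simp
    have Q0: "Q 0 (s j) = a # tl (Q 0 (s j))" using Qp[of 0 "s j"] s[OF j] True q0 by (metis less_one list.collapse)
    \<comment> \<open>With a single link, \<open>Q' 0 j\<close> is itself the whole cycle.\<close>
    have "L.conc Q (\<lambda>i. if Suc i = r then s j else j) r @ tl Cl = Q' 0 j"
      using True Q0 by (simp add: Q'_def)
    then have "cycle G (Q' 0 j)" using cyc[of "\<lambda>_. j"] j by metis
    moreover have "hd (Q' 0 j) = a" using Q0 True by (simp add: Q'_def) (metis hd_append list.distinct(1) list.sel(1))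
    ultimately show ?thesis using True i0 q0 by simp
  next
    case r1: False
    show ?thesis
    proof (cases "Suc i = r")
      case False
      then have "Suc i mod r = Suc i" "Q' i j = Q i j" using i by (auto simp: Q'_def)
      then show ?thesis using ipath_path_between[OF Qp(1)[OF i j]] Qp(2,3)[OF i j] QX[OF i j] X(1) r1 by simp
    next
      case True
      define Z where "Z = Q i (s j)"
      have Z: "ipath Z" "hd Z = q i" "last Z = q r" "Z \<noteq> []" "set Z \<subseteq> X" "set Z \<subseteq> insert (q r) A"
        using Qp[OF i s[OF j]] QX[OF i s[OF j]] QA[OF i s[OF j]] True by (auto simp: Z_def)
      have i0: "0 < i" using r1 r True by simp
      \<comment> \<open>The first link contains \<open>a\<close> and is separated from the last one,
        so attaching a closing path that ends in \<open>a\<close> repeats no vertex.\<close>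
      have "a \<notin> set (tl (Q i 1)) \<union> set (tl (Q i 2))"
        using lk i i0 a0 unfolding L.links_def anti_def by blast
      then have "a \<notin> set (tl Z)" using s[OF j] by (auto simp: Z_def)
      moreover have "a \<noteq> q i" using qne[of 0 i] i0 i q0 by simp
      ultimately have aZ: "a \<notin> set Z" using Z(2,4) by (cases Z) auto
      have disjZ: "set Z \<inter> set (tl Cl) = {}"
        using Z(6) aZ Cl(4) qCl unfolding anti_def by blast
      have tlne: "tl Cl \<noteq> []" using Cl(6) by (cases Cl) auto
      have "successively adj (Z @ tl Cl)"
      proof -
        have "successively adj (q r # tl Cl)" using ipath_successively[OF Cl(1)] Cl(2) Clne by (metis list.collapse)
        then show ?thesis using ipath_successively[OF Z(1)] Z(3) by (auto simp: successively_append_iff successively_Cons)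
      qed
      moreover have "distinct (Z @ tl Cl)" using ipath_distinct[OF Z(1)] ipath_distinct[OF Cl(1)] disjZ
        by (simp add: distinct_tl)
      moreover have "set (Z @ tl Cl) \<subseteq> verts G" using Z(5) ClX tlCl X(1) by auto
      moreover have "last (tl Cl) = a" using Cl(3) tlne by (metis last_tl)
      ultimately have "path_between G (q i) a (Z @ tl Cl)"
        using Z(2,4) tlne by (simp add: path_between_def path_def walk_iff_successively)
      then show ?thesis using True r1 q0 by (simp add: Q'_def Z_def)
    qed
  qed
  have dist: "graph_dist G (q i) (q j) \<ge> 6" if "i < r" "j < r" "i \<noteq> j" for i j
  proof (rule not_near_graph_dist)
    show "\<not> near 5 (q i) (q j)"
      using farq that near_sym[of 5 "q i" "q j"] by (cases "i < j") auto
  qed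
  have "quasi_arithmetic_rope G r q Q'"
    unfolding quasi_arithmetic_rope_def using path par dist cyc by blast
  moreover have "set (Q' i j) \<subseteq> X" if "i < r" "j \<in> {1, 2}" for i j
    using QX[OF that] QX[OF that(1) s[OF that(2)]] ClX tlCl by (auto simp: Q'_def)
  ultimately show ?thesis unfolding has_quasi_arithmetic_rope_in_def by blast
qed

end

lemma chromatic_number_le:
  assumes "proper_colouring G k c" shows "chromatic_number G \<le> k"
  unfolding chromatic_number_def by (rule Least_le) (use assms in blast)

theorem theorem2p3:
  fixes G :: "'a ugraph" and r :: nat and X :: "'a set"
  assumes "r \<ge> 1"
    and "simple_graph G"
    and "odd_girth G \<ge> 15"
    and "X \<subseteq> verts G"
    and "chromatic_number (induced G X) \<ge> (if even r then 16 * r + 5 else 16 * r + 11)"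
  shows "has_quasi_arithmetic_rope_in G r X"
proof -
  interpret graph15 G using assms(2,3) by unfold_locales
  \<comment> \<open>Both cases of the bound exceed \<open>16 * r + 4\<close>.\<close>
  have "\<not> colr (16 * r + 4) X"
  proof
    assume "colr (16 * r + 4) X"
    then obtain c :: "'a \<Rightarrow> nat" where "\<forall>v\<in>X. c v < 16 * r + 4" "\<forall>u\<in>X. \<forall>v\<in>X. adj u v \<longrightarrow> c u \<noteq> c v"
      unfolding colr_def by blast
    then have "proper_colouring (induced G X) (16 * r + 4) c"
      by (auto simp: proper_colouring_def induced_def)
    then show False using chromatic_number_le assms(5) by (fastforce split: if_splits)
  qed
  then show ?thesis using rope_exists assms(1,4) by blast
qed

end
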